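(* Let $Q\in C^\infty(\mathbb R^2)$ be a background potential and let $\Omega\subset\mathbb R^2$ be a bounded convex open domain with smooth boundary. Suppose that $\partial\Omega$ is strictly convex with respect to $Q$ at some point of $\partial\Omega$. Then there exists an open neighborhood $\widetilde\Omega$ of $\overline\Omega$ such that, if in addition $Q$ is known in $\mathbb R^2\setminus\widetilde\Omega$ and real-analytic in $\widetilde\Omega$, then for any open neighborhood $U$ of $\overline{\widetilde\Omega}$ the measurement map $\mathcal S=\mathcal S_Q$ in $U\setminus\Omega$ determines $Q$ in $\widetilde\Omega$. Precisely: if $Q$ is real-analytic in $\widetilde\Omega$, $U$ is any open neighborhood of $\overline{\widetilde\Omega}$, and $Q'\in C^\infty(\mathbb R^2)$ is another background potential that is real-analytic in $\widetilde\Omega$, such that $\partial\Omega$ is strictly convex with respect to $Q'$ at some point of $\partial\Omega$, $Q'=Q$ on $\mathbb R^2\setminus\widetilde\Omega$, and $\mathcal S_{Q'}(x,y)=\mathcal S_Q(x,y)$ for all $(x,y)\in\partial\Omega\times(U\setminus\Omega)$ with $x\ne y$, then $Q'=Q$ in $\widetilde\Omega$.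
   Context: For $w:\mathbb R^2\to\mathbb R$ and $u=(u_1,u_2)\in\mathbb R^2$ write $\nabla^\perp w=(\partial_2 w,-\partial_1 w)$ and $u^\perp=(u_2,-u_1)$. Dipole dynamics. For a background potential $Q$, the vortex dipole $\{a_+,a_-\}$ evolves by $$\dot a_+(s)=\frac1\pi\frac{(a_+-a_-)^\perp}{|a_+-a_-|^2}+\nabla^\perp Q(a_+),\qquad \dot a_-(s)=\frac1\pi\frac{(a_+-a_-)^\perp}{|a_+-a_-|^2}-\nabla^\perp Q(a_-),$$ where $\dot{}=d/ds$. For $x\ne y$, $a_\pm(s,x,y)$ denotes the solution with $a_+(0,x,y)=x$, $a_-(0,x,y)=y$. Measurement map. Let $U$ be an open neighborhood of $\overline\Omega$ and $\Delta=\{(x,x):x\in\partial\Omega\}$. For $(x,y)\in(\partial\Omega\times(U\setminus\Omega))\setminus\Delta$, $\tau_+(x,y)\in[0,\infty]$ is the first nonnegative time at which $a_+(\cdot,x,y)$ exits $\Omega$, i.e. $\tau_+(x,y)=\inf\{s\ge0:a_+(s,x,y)\notin\overline\Omega\}$ (and $\tau_+(x,y)=\infty$ if $a_+(s,x,y)\in\overline\Omega$ for all $s\ge0$). Define $$\mathcal S_Q(x,y)=\begin{cases}\big(\tau_+(x,y),\,a_+(\tau_+(x,y),x,y),\,a_-(\tau_+(x,y),x,y)\big) & \text{if } a_-(\tau_+(x,y),x,y)\notin\Omega,\\ \big(\tau_+(x,y),\,a_+(\tau_+(x,y),x,y)\big) & \text{if } a_-(\tau_+(x,y),x,y)\in\Omega.\end{cases}$$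 Standing assumption on every potential considered: $\tau_+(x,y)<\infty$ for all $(x,y)\in(\partial\Omega\times(U\setminus\Omega))\setminus\Delta$, and the dipole never collides in $\Omega$ (so that $\mathcal S_Q$ is well defined). Strict convexity. For $p\in\partial\Omega$, $\partial\Omega$ is strictly convex at $p$ with respect to $Q$ if there is a small open neighborhood $V_p$ of $p$ such that, whenever $q\in V_p\setminus\Omega$, $q\ne p$, and $\dot a_+(0,p,q)$ is tangent to $\partial\Omega$, there is $\delta>0$ with $a_+(s,p,q)\notin\overline\Omega$ for all $s\in(-\delta,\delta)\setminus\{0\}$. *)

theory Defs
  imports "HOL-Analysis.Analysis"
begin

section \<open>Smooth and real-analytic functions on the plane\<close>

definition partial :: "2 \<Rightarrow> (real^2 \<Rightarrow> real) \<Rightarrow> real^2 \<Rightarrow> real" where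
  "partial i f x = frechet_derivative f (at x) (axis i 1)"

text \<open>Intended for open \<open>S\<close> only, where \<open>differentiable_on\<close> and the unrestricted derivative in
  \<open>partial\<close> agree.\<close>

fun Ck_on :: "nat \<Rightarrow> (real^2) set \<Rightarrow> (real^2 \<Rightarrow> real) \<Rightarrow> bool" where
  "Ck_on 0 S f \<longleftrightarrow> continuous_on S f"
| "Ck_on (Suc k) S f \<longleftrightarrow> f differentiable_on S \<and> (\<forall>i. Ck_on k S (partial i f))"

definition smooth_on :: "(real^2) set \<Rightarrow> (real^2 \<Rightarrow> real) \<Rightarrow> bool" where
  "smooth_on S f \<longleftrightarrow> (\<forall>k. Ck_on k S f)"

definition real_analytic_on :: "(real^2) set \<Rightarrow> (real^2 \<Rightarrow> real) \<Rightarrow> bool" where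
  "real_analytic_on S f \<longleftrightarrow>
     (\<forall>p\<in>S. \<exists>r>0. \<exists>c :: nat \<Rightarrow> nat \<Rightarrow> real. \<forall>x\<in>ball p r.
        ((\<lambda>(i, j). c i j * (x $ 1 - p $ 1) ^ i * (x $ 2 - p $ 2) ^ j) has_sum f x) UNIV)"

definition grad :: "(real^2 \<Rightarrow> real) \<Rightarrow> real^2 \<Rightarrow> real^2" where
  "grad f x = vector [partial 1 f x, partial 2 f x]"

definition perp :: "real^2 \<Rightarrow> real^2" where
  "perp u = vector [u $ 2, - u $ 1]"

definition perp_grad :: "(real^2 \<Rightarrow> real) \<Rightarrow> real^2 \<Rightarrow> real^2" where
  "perp_grad f x = vector [partial 2 f x, - partial 1 f x]"


section \<open>Domains with smooth boundary\<close>

definition local_defining_function ::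
    "(real^2) set \<Rightarrow> real^2 \<Rightarrow> (real^2) set \<Rightarrow> (real^2 \<Rightarrow> real) \<Rightarrow> bool" where
  "local_defining_function \<Omega> p V \<rho> \<longleftrightarrow>
     open V \<and> p \<in> V \<and> smooth_on V \<rho> \<and> (\<forall>x\<in>V. grad \<rho> x \<noteq> 0) \<and> \<Omega> \<inter> V = {x\<in>V. \<rho> x < 0}"

definition smooth_boundary :: "(real^2) set \<Rightarrow> bool" where
  "smooth_boundary \<Omega> \<longleftrightarrow> (\<forall>p\<in>frontier \<Omega>. \<exists>V \<rho>. local_defining_function \<Omega> p V \<rho>)"

text \<open>The tangent space of the boundary at \<open>p\<close> is the kernel of the differential of a local
  defining function; it does not depend on the choice of the latter.\<close>

definition tangent_to_boundary :: "(real^2) set \<Rightarrow> real^2 \<Rightarrow> real^2 \<Rightarrow> bool" where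
  "tangent_to_boundary \<Omega> p v \<longleftrightarrow>
     (\<exists>V \<rho>. local_defining_function \<Omega> p V \<rho> \<and> grad \<rho> p \<bullet> v = 0)"


section \<open>Dipole dynamics\<close>

definition dipole_solution ::
    "(real^2 \<Rightarrow> real) \<Rightarrow> real^2 \<Rightarrow> real^2 \<Rightarrow> real set \<Rightarrow> (real \<Rightarrow> real^2) \<Rightarrow> (real \<Rightarrow> real^2) \<Rightarrow> bool" where
  "dipole_solution Q x y J ap am \<longleftrightarrow>
     open J \<and> is_interval J \<and> 0 \<in> J \<and> ap 0 = x \<and> am 0 = y \<and>
     (\<forall>s\<in>J. ap s \<noteq> am s \<and>
        (ap has_vector_derivative
           (1 / pi) *\<^sub>R (perp (ap s - am s) /\<^sub>R (norm (ap s - am s))\<^sup>2) + perp_grad Q (ap s)) (at s) \<and>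
        (am has_vector_derivative
           (1 / pi) *\<^sub>R (perp (ap s - am s) /\<^sub>R (norm (ap s - am s))\<^sup>2) - perp_grad Q (am s)) (at s))"

text \<open>The maximal solution. For smooth \<open>Q\<close> any two solutions agree on the intersection of their
  intervals, so the description operators below are well defined on the maximal interval of
  existence \<open>life Q x y\<close>. Outside this interval the values of \<open>a_plus\<close> and \<open>a_minus\<close> carry no
  meaning.\<close>

definition life :: "(real^2 \<Rightarrow> real) \<Rightarrow> real^2 \<Rightarrow> real^2 \<Rightarrow> real set" where
  "life Q x y = \<Union> {J. \<exists>ap am. dipole_solution Q x y J ap am}"

definition a_plus :: "(real^2 \<Rightarrow> real) \<Rightarrow> real^2 \<Rightarrow> real^2 \<Rightarrow> real \<Rightarrow> real^2" where
  "a_plus Q x y s = (THE z. \<exists>J ap am. dipole_solution Q x y J ap am \<and> s \<in> J \<and> ap s = z)"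

definition a_minus :: "(real^2 \<Rightarrow> real) \<Rightarrow> real^2 \<Rightarrow> real^2 \<Rightarrow> real \<Rightarrow> real^2" where
  "a_minus Q x y s = (THE z. \<exists>J ap am. dipole_solution Q x y J ap am \<and> s \<in> J \<and> am s = z)"


section \<open>Measurement map\<close>

text \<open>Infinite if there is no exit during the lifetime of the solution. If it is finite, it lies
  in \<open>life Q x y\<close>, because some later or equal time does.\<close>

definition exit_time :: "(real^2 \<Rightarrow> real) \<Rightarrow> (real^2) set \<Rightarrow> real^2 \<Rightarrow> real^2 \<Rightarrow> ereal" where
  "exit_time Q \<Omega> x y =
     Inf (ereal ` {s. 0 \<le> s \<and> s \<in> life Q x y \<and> a_plus Q x y s \<notin> closure \<Omega>})"

text \<open>\<open>Inl\<close> tags the triples and \<open>Inr\<close> the pairs, so that an equation between two values also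
  says that both are of the same kind.\<close>

definition measurement ::
    "(real^2 \<Rightarrow> real) \<Rightarrow> (real^2) set \<Rightarrow> real^2 \<Rightarrow> real^2 \<Rightarrow>
       (ereal \<times> (real^2) \<times> (real^2)) + (ereal \<times> (real^2))" where
  "measurement Q \<Omega> x y =
     (let \<tau> = exit_time Q \<Omega> x y; t = real_of_ereal \<tau> in
      if a_minus Q x y t \<notin> \<Omega> then Inl (\<tau>, a_plus Q x y t, a_minus Q x y t)
      else Inr (\<tau>, a_plus Q x y t))"

text \<open>A collision is excluded at any time of a solution, so it can only occur as a limit at the
  end of the lifetime.\<close>

definition collides_in :: "(real^2 \<Rightarrow> real) \<Rightarrow> (real^2) set \<Rightarrow> real^2 \<Rightarrow> real^2 \<Rightarrow> bool" where
  "collides_in Q \<Omega> x y \<longleftrightarrow>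
     (\<exists>T>0. \<exists>z\<in>\<Omega>. {0..<T} \<subseteq> life Q x y \<and>
        (a_plus Q x y \<longlongrightarrow> z) (at_left T) \<and> (a_minus Q x y \<longlongrightarrow> z) (at_left T))"

definition admissible_potential ::
    "(real^2) set \<Rightarrow> (real^2) set \<Rightarrow> (real^2 \<Rightarrow> real) \<Rightarrow> bool" where
  "admissible_potential \<Omega> U Q \<longleftrightarrow>
     (\<forall>x\<in>frontier \<Omega>. \<forall>y\<in>U - \<Omega>. x \<noteq> y \<longrightarrow> exit_time Q \<Omega> x y < \<infinity> \<and> \<not> collides_in Q \<Omega> x y)"


section \<open>Strict convexity with respect to a potential\<close>

definition strictly_convex_wrt ::
    "(real^2 \<Rightarrow> real) \<Rightarrow> (real^2) set \<Rightarrow> real^2 \<Rightarrow> bool" where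
  "strictly_convex_wrt Q \<Omega> p \<longleftrightarrow>
     (\<exists>V. open V \<and> p \<in> V \<and>
        (\<forall>q\<in>V - \<Omega>. q \<noteq> p \<and> tangent_to_boundary \<Omega> p (vector_derivative (a_plus Q p q) (at 0)) \<longrightarrow>
           (\<exists>\<delta>>0. \<forall>s\<in>{-\<delta><..<\<delta>} - {0}. s \<in> life Q p q \<and> a_plus Q p q s \<notin> closure \<Omega>)))"

end

theory Submission
  imports Defs "HOL-Complex_Analysis.Cauchy_Integral_Formula"
begin

text \<open>Take \<open>W\<close> to be a large disc. If a dipole starting at \<open>(x, y)\<close>, with \<open>x\<close> on the boundary and \<open>y\<close>
  outside, sends its first vortex along ever shorter chords of the domain, then the displacement of
  the second vortex divided by the exit time tends to the initial velocity of the second vortex. The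
  measurements therefore determine the gradient of the potential at every such \<open>y\<close>. Short chords
  exist near a tangential state whose trajectory curves strictly outwards to second order. If there
  were no such states near a suitable tangential state \<open>(p, q)\<close>, a differential inequality for the
  defining function along the trajectory of \<open>(p, q)\<close> would keep this trajectory in the closed domain,
  contrary to strict convexity at \<open>p\<close>. For \<open>q\<close> close to \<open>p\<close> the tangential states near \<open>(p, q)\<close> are
  parametrized by the position of the second vortex, so the points \<open>y\<close> obtained cannot avoid an open
  set. Hence the gradients agree on a nonempty open set, and analyticity together with the agreement
  outside \<open>W\<close> does the rest.\<close>

text \<open>Strict convexity is a purely qualitative condition: the trajectory of
  \<open>(p, q)\<close> may leave with contact of order higher than two, so \<open>k\<close>, the
  second derivative of \<open>\<rho>\<close> along it, may vanish there, and short chords at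
  \<open>(p, q)\<close> itself cannot be expected. The argument therefore runs backwards. At a
  \<open>b\<close> where the two gradients differ, \<open>k\<close> must be nonpositive at every
  tangential state near \<open>(p, q)\<close> with this \<open>b\<close>; if such \<open>b\<close>
  were dense, continuity would give this at all nearby tangential states. Elsewhere \<open>k\<close>
  is then at most a constant times \<open>\<bar>\<rho>\<bar> + \<bar>f\<bar>\<close>, with
  \<open>f\<close> the normal speed, because \<open>k\<close> is Lipschitz and these two residuals
  control the distance to a tangential state. Such control requires independent differentials of
  \<open>\<rho>\<close> and \<open>f\<close> in the first vortex, which the large vortex velocity
  for \<open>q\<close> near \<open>p\<close> provides. It is the second vortex that is compared:
  outside the closed domain its position at the exit time belongs to the data, and its interaction
  velocity at \<open>(x0, b)\<close> is common to both potentials. Solutions are extracted from the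
  finiteness of exit times.\<close>

section \<open>Real-analytic functions on segments\<close>

text \<open>A power series without constant term but with a nonzero coefficient has an isolated zero
  at the origin; applied to \<open>\<phi> - c\<close>, the accumulating points of
  \<open>zeros\<close> force all coefficients of positive index to vanish.\<close>

lemma powser_real_locally_constant:
  fixes \<phi> :: "real \<Rightarrow> real"
  assumes r: "r > 0" and sums: "\<And>h. \<bar>h\<bar> < r \<Longrightarrow> (\<lambda>n. a n * h ^ n) sums \<phi> (t + h)"
    and c: "\<phi> t = c"
    and zeros: "\<And>e. e > 0 \<Longrightarrow> \<exists>h. h \<noteq> 0 \<and> \<bar>h\<bar> < e \<and> \<phi> (t + h) = c"
    and h: "\<bar>h\<bar> < r"
  shows "\<phi> (t + h) = c"
proof -
  have a0: "a 0 = c"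
    using sums[of 0] r c by simp
  have vanish: "a m = 0" if m: "m > 0" for m
  proof (rule ccontr)
    assume "a m \<noteq> 0"
    define b where "b n = (if n = 0 then 0 else a n)" for n
    have b: "(\<lambda>n. b n * (x - 0) ^ n) sums (\<phi> (t + x) - c)" if "norm (x - 0) < r" for x
    proof -
      have "(\<lambda>n. a n * x ^ n - (if n = 0 then c else 0)) sums (\<phi> (t + x) - c)"
        by (intro sums_diff sums sums_single) (use that in auto)
      moreover have "(\<lambda>n. a n * x ^ n - (if n = 0 then c else 0)) = (\<lambda>n. b n * (x - 0) ^ n)"
        using a0 by (auto simp: b_def fun_eq_iff)
      ultimately show ?thesis by simp
    qed
    obtain s where s: "s > 0" "\<And>z. z \<in> cball 0 s - {0} \<Longrightarrow> \<phi> (t + z) - c \<noteq> 0"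
      by (rule powser_0_nonzero[OF r b, where m = m]) (use \<open>a m \<noteq> 0\<close> m c in \<open>auto simp: b_def\<close>)
    obtain h where "h \<noteq> 0" "\<bar>h\<bar> < s" "\<phi> (t + h) = c"
      using zeros[OF s(1)] by blast
    then show False using s(2)[of h] by (auto simp: dist_norm)
  qed
  have "(\<lambda>n. a n * h ^ n) = (\<lambda>n. if n = 0 then c else 0)"
    using vanish a0 by (auto simp: fun_eq_iff)
  then have "(\<lambda>n. a n * h ^ n) sums c"
    using sums_single[of 0 "\<lambda>n. c"] by simp
  then show ?thesis using sums[OF h] sums_unique2 by blast
qed

text \<open>The supremum \<open>S\<close> of the initial intervals on which
  \<open>\<phi> = c\<close> is attained by continuity, and the expansion at \<open>S\<close> carries
  the constancy beyond \<open>S\<close> unless \<open>S = 1\<close>.\<close>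

lemma powser_real_constant_on_segment:
  fixes \<phi> :: "real \<Rightarrow> real"
  assumes cont: "continuous_on {0..1} \<phi>"
    and an: "\<And>t. t \<in> {0..1} \<Longrightarrow> \<exists>r>0. \<exists>a. \<forall>h. \<bar>h\<bar> < r \<longrightarrow> (\<lambda>n. a n * h ^ n) sums \<phi> (t + h)"
    and \<eta>: "0 < \<eta>" "\<eta> \<le> 1" "\<And>t. t \<in> {0..\<eta>} \<Longrightarrow> \<phi> t = c"
  shows "\<phi> 1 = c"
proof -
  define A where "A = {s\<in>{0..1}. \<forall>t\<in>{0..s}. \<phi> t = c}"
  define S where "S = Sup A"
  have \<eta>A: "\<eta> \<in> A" using \<eta> by (auto simp: A_def)
  have bdd: "bdd_above A" by (rule bdd_aboveI[of _ 1]) (auto simp: A_def)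
  have S\<eta>: "\<eta> \<le> S" unfolding S_def by (rule cSup_upper[OF \<eta>A bdd])
  have S1: "S \<le> 1" unfolding S_def using \<eta>A by (intro cSup_least) (auto simp: A_def)
  have less: "\<phi> t = c" if t: "0 \<le> t" "t < S" for t
  proof -
    obtain s where "s \<in> A" "t < s"
      using t less_cSup_iff[of A t] \<eta>A bdd unfolding S_def by blast
    then show ?thesis using t by (auto simp: A_def)
  qed
  have "\<phi> S = c"
  proof (rule ccontr)
    assume "\<phi> S \<noteq> c"
    then have "dist c (\<phi> S) > 0" by simp
    moreover have "S \<in> {0..1}" using S\<eta> S1 \<eta>(1) by simp
    ultimately obtain e where e: "e > 0" "\<And>t. t \<in> {0..1} \<Longrightarrow> dist t S < e \<Longrightarrow> dist (\<phi> t) (\<phi> S) < dist c (\<phi> S)"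
      using cont unfolding continuous_on_iff by blast
    define t where "t = max 0 (S - e / 2)"
    have "0 \<le> t" "t < S" "dist t S < e" using e S\<eta> \<eta>(1) by (auto simp: t_def dist_real_def)
    then show False using e(2)[of t] less[of t] S1 by auto
  qed
  then have le: "\<phi> t = c" if "0 \<le> t" "t \<le> S" for t using less[of t] that by force
  obtain r a where r: "r > 0" and a: "\<And>h. \<bar>h\<bar> < r \<Longrightarrow> (\<lambda>n. a n * h ^ n) sums \<phi> (S + h)"
    using an[of S] S\<eta> S1 \<eta>(1) by auto
  have near: "\<phi> (S + h) = c" if "\<bar>h\<bar> < r" for h
  proof (rule powser_real_locally_constant[OF r a \<open>\<phi> S = c\<close> _ that])
    fix e :: real assume "e > 0"
    \<comment> \<open>Accumulation from the left: the minimum with \<open>S\<close> keeps the point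
      in \<open>[0, S]\<close>, and it differs from \<open>S\<close> because
      \<open>S \<ge> \<eta> > 0\<close>.\<close>
    then have "\<phi> (S + - min (e/2) S) = c" by (intro le) (use S\<eta> \<eta>(1) in auto)
    then show "\<exists>h. h \<noteq> 0 \<and> \<bar>h\<bar> < e \<and> \<phi> (S + h) = c"
      using \<open>e > 0\<close> S\<eta> \<eta>(1) by (intro exI[of _ "- min (e/2) S"]) auto
  qed auto
  have "S = 1"
  proof (rule ccontr)
    assume "S \<noteq> 1"
    define s where "s = min 1 (S + r/2)"
    have "\<phi> t = c" if "t \<in> {0..s}" for t
    proof (cases "t \<le> S")
      case False
      then show ?thesis using near[of "t - S"] that r by (auto simp: s_def)
    qed (use le that in auto)
    then have "s \<in> A" using r S\<eta> \<eta>(1) by (auto simp: A_def s_def)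
    then have "s \<le> S" unfolding S_def by (rule cSup_upper[OF _ bdd])
    then show False using \<open>S \<noteq> 1\<close> S1 r by (auto simp: s_def)
  qed
  then show ?thesis using \<open>\<phi> S = c\<close> by simp
qed

text \<open>On the line the monomial of index \<open>(i, j)\<close> becomes a multiple of
  \<open>h ^ (i + j)\<close>; as \<open>has_sum\<close> is unordered, the double series may be
  regrouped by total degree. The \<open>+ 1\<close> in the radius covers
  \<open>v = 0\<close>.\<close>

lemma real_analytic_on_line:
  assumes "real_analytic_on W f" "p \<in> W"
  shows "\<exists>r>0. \<exists>a. \<forall>h. \<bar>h\<bar> < r \<longrightarrow> (\<lambda>n. a n * h ^ n) sums f (p + h *\<^sub>R v)"
proof -
  from bspec[OF assms(1)[unfolded real_analytic_on_def] assms(2)]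
  obtain r c where r: "r > 0" and c: "\<forall>x\<in>ball p r.
      ((\<lambda>(i, j). c i j * (x $ 1 - p $ 1) ^ i * (x $ 2 - p $ 2) ^ j) has_sum f x) UNIV"
    by blast
  define a where "a n = (\<Sum>i\<le>n. c i (n - i) * (v $ 1) ^ i * (v $ 2) ^ (n - i))" for n
  have "(\<lambda>n. a n * h ^ n) sums f (p + h *\<^sub>R v)" if h: "\<bar>h\<bar> < r / (norm v + 1)" for h
  proof -
    have "\<bar>h\<bar> * norm v \<le> \<bar>h\<bar> * (norm v + 1)" by (intro mult_left_mono) auto
    also have "\<dots> < r" using h by (simp add: field_simps add_pos_nonneg)
    finally have "p + h *\<^sub>R v \<in> ball p r" by (simp add: dist_norm)
    from bspec[OF c this] have s: "((\<lambda>(i, j). c i j * (h * v $ 1) ^ i * (h * v $ 2) ^ j) has_sum f (p + h *\<^sub>R v)) UNIV"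
      by simp
    have "((\<lambda>(n, i). c i (n - i) * (h * v $ 1) ^ i * (h * v $ 2) ^ (n - i)) has_sum f (p + h *\<^sub>R v))
        (Sigma UNIV (\<lambda>n. {..n}))"
      by (rule iffD1[OF has_sum_reindex_bij_witness[where i = "\<lambda>(n, i). (i, n - i)" and j = "\<lambda>(i, j). (i + j, i)"] s])
        auto
    then have "((\<lambda>n. a n * h ^ n) has_sum f (p + h *\<^sub>R v)) UNIV"
    proof (rule has_sum_Sigma')
      fix n :: nat
      have "(\<Sum>i\<le>n. c i (n - i) * (h * v $ 1) ^ i * (h * v $ 2) ^ (n - i)) = a n * h ^ n"
        unfolding a_def sum_distrib_right
      proof (rule sum.cong)
        fix i assume "i \<in> {..n}"
        then have hn: "h ^ n = h ^ i * h ^ (n - i)" by (metis atMost_iff le_add_diff_inverse power_add)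
        show "c i (n - i) * (h * v $ 1) ^ i * (h * v $ 2) ^ (n - i) =
            c i (n - i) * (v $ 1) ^ i * (v $ 2) ^ (n - i) * h ^ n"
          unfolding hn power_mult_distrib by (simp only: mult_ac)
      qed simp
      then show "((\<lambda>i. case (n, i) of (n, i) \<Rightarrow> c i (n - i) * (h * v $ 1) ^ i * (h * v $ 2) ^ (n - i)) has_sum a n * h ^ n) {..n}"
        using has_sum_finite[of "{..n}" "\<lambda>i. c i (n - i) * (h * v $ 1) ^ i * (h * v $ 2) ^ (n - i)"] by simp
    qed
    then show ?thesis by (rule has_sum_imp_sums)
  qed
  then show ?thesis using r by (intro exI[of _ "r / (norm v + 1)"]) (auto simp: add_nonneg_pos)
qed

text \<open>Convexity keeps the segment from \<open>y\<close> to \<open>z\<close> in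
  \<open>W\<close>, so the claim reduces to one variable; \<open>\<eta>\<close> measures an initial
  piece of the segment inside \<open>ball y e\<close>.\<close>

lemma real_analytic_diff_constant:
  assumes an: "real_analytic_on W f" "real_analytic_on W g" and "convex W"
    and cont: "continuous_on W f" "continuous_on W g"
    and y: "y \<in> W" and e: "e > 0" and const: "\<And>x. x \<in> ball y e \<Longrightarrow> f x - g x = c"
    and z: "z \<in> W"
  shows "f z - g z = c"
proof -
  define l where "l t = y + t *\<^sub>R (z - y)" for t
  have lW: "l t \<in> W" if "t \<in> {0..1}" for t
    using convexD[OF \<open>convex W\<close> y z, of "1 - t" t] that by (simp add: l_def algebra_simps)
  have "continuous_on {0..1} l" unfolding l_def by (intro continuous_intros)
  then have c: "continuous_on {0..1} (\<lambda>t. f (l t) - g (l t))"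
    using lW by (intro continuous_on_diff continuous_on_compose2[OF cont(1)] continuous_on_compose2[OF cont(2)]) auto
  have a: "\<exists>r>0. \<exists>a. \<forall>h. \<bar>h\<bar> < r \<longrightarrow> (\<lambda>n. a n * h ^ n) sums (f (l (t + h)) - g (l (t + h)))"
    if t: "t \<in> {0..1}" for t
  proof -
    obtain r a where r: "r > 0" "\<And>h. \<bar>h\<bar> < r \<Longrightarrow> (\<lambda>n. a n * h ^ n) sums f (l t + h *\<^sub>R (z - y))"
      using real_analytic_on_line[OF an(1) lW[OF t]] by blast
    obtain r' a' where r': "r' > 0" "\<And>h. \<bar>h\<bar> < r' \<Longrightarrow> (\<lambda>n. a' n * h ^ n) sums g (l t + h *\<^sub>R (z - y))"
      using real_analytic_on_line[OF an(2) lW[OF t]] by blast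
    have eq: "l t + h *\<^sub>R (z - y) = l (t + h)" for h by (simp add: l_def algebra_simps)
    have "(\<lambda>n. (a n - a' n) * h ^ n) sums (f (l (t + h)) - g (l (t + h)))" if "\<bar>h\<bar> < min r r'" for h
      using sums_diff[OF r(2) r'(2), of h h] that unfolding eq by (simp add: left_diff_distrib)
    then show ?thesis using r(1) r'(1)
      by (intro exI[of _ "min r r'"] conjI exI[of _ "\<lambda>n. a n - a' n"]) auto
  qed
  define \<eta> where "\<eta> = min 1 (e / 2 / (norm (z - y) + 1))"
  have \<eta>: "0 < \<eta>" "\<eta> \<le> 1" using e by (auto simp: \<eta>_def intro!: divide_pos_pos add_nonneg_pos)
  have d: "f (l t) - g (l t) = c" if "t \<in> {0..\<eta>}" for t
  proof (rule const)
    have "t * norm (z - y) \<le> t * (norm (z - y) + 1)" using that by (intro mult_left_mono) auto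
    also have "\<dots> \<le> e / 2 / (norm (z - y) + 1) * (norm (z - y) + 1)"
      using that by (intro mult_right_mono) (auto simp: \<eta>_def)
    also have "\<dots> = e / 2"
    proof -
      have "norm (z - y) + 1 \<noteq> 0" by (smt (verit) norm_ge_zero)
      then show ?thesis by (metis nonzero_mult_div_cancel_right times_divide_eq_left)
    qed
    also have "\<dots> < e" using e by simp
    finally show "l t \<in> ball y e" using that by (simp add: l_def dist_norm)
  qed
  have "f (l 1) - g (l 1) = c"
    by (rule powser_real_constant_on_segment[OF c a \<eta> d])
  then show ?thesis by (simp add: l_def)
qed

section \<open>Functions with continuous partial derivatives up to a given order\<close>

text \<open>\<open>Ck_on\<close> is tied to \<open>real^2\<close>, whereas the dipole field lives on
  pairs of points. The partial derivatives are existential witnesses, so that each closure lemma can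
  simply supply a formula.\<close>

fun CK :: "nat \<Rightarrow> 'a::euclidean_space set \<Rightarrow> ('a \<Rightarrow> real) \<Rightarrow> bool" where
  "CK 0 S f \<longleftrightarrow> continuous_on S f"
| "CK (Suc n) S f \<longleftrightarrow> (\<exists>f'. (\<forall>x\<in>S. (f has_derivative (\<lambda>h. \<Sum>i\<in>Basis. (h \<bullet> i) * f' i x)) (at x)) \<and>
     (\<forall>i\<in>Basis. CK n S (f' i)))"

lemma CK_SucI:
  assumes "\<And>x. x \<in> S \<Longrightarrow> (f has_derivative (\<lambda>h. \<Sum>i\<in>Basis. (h \<bullet> i) * f' i x)) (at x)"
    and "\<And>i. i \<in> Basis \<Longrightarrow> CK n S (f' i)"
  shows "CK (Suc n) S f"
  using assms by auto

lemma CK_SucE: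
  assumes "CK (Suc n) S f"
  obtains f' where "\<And>x. x \<in> S \<Longrightarrow> (f has_derivative (\<lambda>h. \<Sum>i\<in>Basis. (h \<bullet> i) * f' i x)) (at x)"
    and "\<And>i. i \<in> Basis \<Longrightarrow> CK n S (f' i)"
  using assms by auto

lemma CK_imp_continuous_on: "CK n S f \<Longrightarrow> continuous_on S f"
proof (cases n)
  case (Suc m)
  assume "CK n S f"
  then obtain f' where "\<forall>x\<in>S. (f has_derivative (\<lambda>h. \<Sum>i\<in>Basis. (h \<bullet> i) * f' i x)) (at x)"
    unfolding Suc by auto
  then show ?thesis
    by (intro continuous_at_imp_continuous_on ballI has_derivative_continuous) blast
qed simp

lemma CK_Suc_imp: "CK (Suc n) S f \<Longrightarrow> CK n S f"
proof (induction n arbitrary: f)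
  case 0
  then show ?case using CK_imp_continuous_on[OF 0] by simp
next
  case (Suc n)
  from CK_SucE[OF Suc.prems] obtain f' where
    "\<And>x. x \<in> S \<Longrightarrow> (f has_derivative (\<lambda>h. \<Sum>i\<in>Basis. (h \<bullet> i) * f' i x)) (at x)"
    "\<And>i. i \<in> Basis \<Longrightarrow> CK (Suc n) S (f' i)" by blast
  then show ?case by (intro CK_SucI) (auto intro: Suc.IH simp del: CK.simps)
qed

lemma CK_subset: "CK n S f \<Longrightarrow> T \<subseteq> S \<Longrightarrow> CK n T f"
proof (induction n arbitrary: f)
  case (Suc n)
  then show ?case by (auto 0 4)
qed (auto intro: continuous_on_subset)

lemma CK_const [intro]: "CK n S (\<lambda>x. c)"
proof (induction n arbitrary: c)
  case (Suc n)
  then show ?case by (intro CK_SucI[where f' = "\<lambda>i x. 0"]) auto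
qed simp

lemma CK_linear: "bounded_linear L \<Longrightarrow> CK n S L"
proof (cases n)
  case (Suc m)
  assume L: "bounded_linear L"
  have "L = (\<lambda>h. \<Sum>i\<in>Basis. (h \<bullet> i) * L i)"
  proof
    fix h
    have "L h = L (\<Sum>i\<in>Basis. (h \<bullet> i) *\<^sub>R i)" by (simp add: euclidean_representation)
    also have "\<dots> = (\<Sum>i\<in>Basis. (h \<bullet> i) * L i)"
      using L by (simp add: linear_sum linear_scale bounded_linear.linear)
    finally show "L h = (\<Sum>i\<in>Basis. (h \<bullet> i) * L i)" .
  qed
  then show ?thesis unfolding Suc using bounded_linear_imp_has_derivative[OF L]
    by (intro CK_SucI[where f' = "\<lambda>i x. L i"]) (auto simp del: CK.simps)
qed (simp add: linear_continuous_on)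

lemma CK_add [intro]: "CK n S f \<Longrightarrow> CK n S g \<Longrightarrow> CK n S (\<lambda>x. f x + g x)"
proof (induction n arbitrary: f g)
  case (Suc n)
  obtain f' where f': "\<And>x. x \<in> S \<Longrightarrow> (f has_derivative (\<lambda>h. \<Sum>i\<in>Basis. (h \<bullet> i) * f' i x)) (at x)"
    "\<And>i. i \<in> Basis \<Longrightarrow> CK n S (f' i)" using CK_SucE[OF Suc.prems(1)] by blast
  obtain g' where g': "\<And>x. x \<in> S \<Longrightarrow> (g has_derivative (\<lambda>h. \<Sum>i\<in>Basis. (h \<bullet> i) * g' i x)) (at x)"
    "\<And>i. i \<in> Basis \<Longrightarrow> CK n S (g' i)" using CK_SucE[OF Suc.prems(2)] by blast
  show ?case
  proof (rule CK_SucI[where f' = "\<lambda>i x. f' i x + g' i x"])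
    fix x assume x: "x \<in> S"
    then show "((\<lambda>x. f x + g x) has_derivative (\<lambda>h. \<Sum>i\<in>Basis. (h \<bullet> i) * (f' i x + g' i x))) (at x)"
      using has_derivative_add[OF f'(1)[OF x] g'(1)[OF x]] by (simp add: sum.distrib distrib_left)
  qed (use Suc.IH f'(2) g'(2) in blast)
qed (auto intro: continuous_intros)

lemma CK_mult [intro]: "CK n S f \<Longrightarrow> CK n S g \<Longrightarrow> CK n S (\<lambda>x. f x * g x)"
proof (induction n arbitrary: f g)
  case (Suc n)
  obtain f' where f': "\<And>x. x \<in> S \<Longrightarrow> (f has_derivative (\<lambda>h. \<Sum>i\<in>Basis. (h \<bullet> i) * f' i x)) (at x)"
    "\<And>i. i \<in> Basis \<Longrightarrow> CK n S (f' i)" using CK_SucE[OF Suc.prems(1)] by blast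
  obtain g' where g': "\<And>x. x \<in> S \<Longrightarrow> (g has_derivative (\<lambda>h. \<Sum>i\<in>Basis. (h \<bullet> i) * g' i x)) (at x)"
    "\<And>i. i \<in> Basis \<Longrightarrow> CK n S (g' i)" using CK_SucE[OF Suc.prems(2)] by blast
  have n: "CK n S f" "CK n S g" using Suc.prems CK_Suc_imp by blast+
  show ?case
  proof (rule CK_SucI[where f' = "\<lambda>i x. f x * g' i x + f' i x * g x"])
    fix x assume x: "x \<in> S"
    then show "((\<lambda>x. f x * g x) has_derivative (\<lambda>h. \<Sum>i\<in>Basis. (h \<bullet> i) * (f x * g' i x + f' i x * g x))) (at x)"
      using has_derivative_mult[OF f'(1)[OF x] g'(1)[OF x]]
      by (simp add: sum.distrib distrib_left sum_distrib_left sum_distrib_right mult_ac)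
  next
    fix i :: 'a assume "i \<in> Basis"
    then show "CK n S (\<lambda>x. f x * g' i x + f' i x * g x)"
      by (intro CK_add Suc.IH n f'(2) g'(2))
  qed
qed (auto intro: continuous_intros)

lemma CK_uminus [intro]: "CK n S f \<Longrightarrow> CK n S (\<lambda>x. - f x)"
  using CK_mult[OF CK_const[of n S "-1"], of f] by simp

lemma CK_diff [intro]: "CK n S f \<Longrightarrow> CK n S g \<Longrightarrow> CK n S (\<lambda>x. f x - g x)"
  using CK_add[OF _ CK_uminus, of n S f g] by simp

lemma CK_inverse [intro]: "CK n S f \<Longrightarrow> (\<And>x. x \<in> S \<Longrightarrow> f x \<noteq> 0) \<Longrightarrow> CK n S (\<lambda>x. inverse (f x))"
proof (induction n arbitrary: f)
  case (Suc n)
  obtain f' where f': "\<And>x. x \<in> S \<Longrightarrow> (f has_derivative (\<lambda>h. \<Sum>i\<in>Basis. (h \<bullet> i) * f' i x)) (at x)"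
    "\<And>i. i \<in> Basis \<Longrightarrow> CK n S (f' i)" using CK_SucE[OF Suc.prems(1)] by blast
  have n: "CK n S (\<lambda>x. inverse (f x))" using Suc.prems Suc.IH CK_Suc_imp by blast
  show ?case
  proof (rule CK_SucI[where f' = "\<lambda>i x. - (inverse (f x) * f' i x * inverse (f x))"])
    fix x assume x: "x \<in> S"
    show "((\<lambda>x. inverse (f x)) has_derivative
       (\<lambda>h. \<Sum>i\<in>Basis. (h \<bullet> i) * - (inverse (f x) * f' i x * inverse (f x)))) (at x)"
      using Deriv.has_derivative_inverse[OF Suc.prems(2)[OF x] f'(1)[OF x]]
      by (simp add: sum_distrib_left sum_distrib_right sum_negf mult_ac)
  next
    fix i :: 'a assume "i \<in> Basis"
    then show "CK n S (\<lambda>x. - (inverse (f x) * f' i x * inverse (f x)))"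
      by (intro CK_uminus CK_mult n f'(2))
  qed
qed (auto intro: continuous_on_inverse)

lemma CK_sum: "(\<And>i. i \<in> A \<Longrightarrow> CK n S (f i)) \<Longrightarrow> CK n S (\<lambda>x. \<Sum>i\<in>A. f i x)"
  by (induction A rule: infinite_finite_induct) (auto simp del: CK.simps)

text \<open>The inner maps that occur are \<open>fst\<close>, \<open>snd\<close> and their
  difference. For linear \<open>L\<close> the chain rule has constant coefficients, so the induction
  on \<open>n\<close> closes with sums and products alone.\<close>

lemma CK_compose_linear:
  fixes L :: "'b::euclidean_space \<Rightarrow> 'a::euclidean_space"
  assumes L: "bounded_linear L" and T: "L ` T \<subseteq> S"
  shows "CK n S f \<Longrightarrow> CK n T (\<lambda>x. f (L x))"
proof (induction n arbitrary: f)
  case 0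
  then show ?case using T by (auto intro: continuous_on_compose2 linear_continuous_on[OF L])
next
  case (Suc n)
  obtain f' where f': "\<And>x. x \<in> S \<Longrightarrow> (f has_derivative (\<lambda>h. \<Sum>i\<in>Basis. (h \<bullet> i) * f' i x)) (at x)"
    "\<And>i. i \<in> Basis \<Longrightarrow> CK n S (f' i)" using CK_SucE[OF Suc.prems(1)] by blast
  show ?case
  proof (rule CK_SucI[where f' = "\<lambda>j x. \<Sum>i\<in>Basis. (L j \<bullet> i) * f' i (L x)"])
    fix x assume "x \<in> T"
    then have "L x \<in> S" using T by auto
    from has_derivative_compose[OF bounded_linear_imp_has_derivative[OF L] f'(1)[OF this]]
    have d: "((\<lambda>x. f (L x)) has_derivative (\<lambda>h. \<Sum>i\<in>Basis. (L h \<bullet> i) * f' i (L x))) (at x)" .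
    have e: "(\<Sum>i\<in>Basis. (L h \<bullet> i) * f' i (L x)) =
        (\<Sum>j\<in>Basis. (h \<bullet> j) * (\<Sum>i\<in>Basis. (L j \<bullet> i) * f' i (L x)))" for h
    proof -
      have "L h = L (\<Sum>j\<in>Basis. (h \<bullet> j) *\<^sub>R j)" by (simp add: euclidean_representation)
      also have "\<dots> = (\<Sum>j\<in>Basis. (h \<bullet> j) *\<^sub>R L j)"
        using L by (simp add: linear_sum linear_scale bounded_linear.linear)
      finally have *: "L h = (\<Sum>j\<in>Basis. (h \<bullet> j) *\<^sub>R L j)" .
      show ?thesis unfolding * inner_sum_left sum_distrib_left sum_distrib_right
        by (subst sum.swap) (simp add: mult_ac)
    qed
    show "((\<lambda>x. f (L x)) has_derivative
        (\<lambda>h. \<Sum>j\<in>Basis. (h \<bullet> j) * (\<Sum>i\<in>Basis. (L j \<bullet> i) * f' i (L x)))) (at x)"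
      by (rule has_derivative_eq_rhs[OF d ext[OF e]])
  next
    fix j :: 'b assume "j \<in> Basis"
    show "CK n T (\<lambda>x. \<Sum>i\<in>Basis. (L j \<bullet> i) * f' i (L x))"
      by (intro CK_sum CK_mult CK_const Suc.IH f'(2))
  qed
qed

section \<open>Strict differentiability and local Lipschitz bounds\<close>

text \<open>Once the differential at \<open>x0\<close> is subtracted, the rest has small derivative
  on a ball by continuity of the partials, and the mean value inequality on this convex set gives
  the two-point bound.\<close>

lemma C1_strictly_differentiable:
  fixes f :: "'a::euclidean_space \<Rightarrow> real"
  assumes f': "\<And>x. x \<in> S \<Longrightarrow> (f has_derivative (\<lambda>h. \<Sum>i\<in>Basis. (h \<bullet> i) * f' i x)) (at x)"
    and cont: "\<And>i. i \<in> Basis \<Longrightarrow> continuous_on S (f' i)"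
    and S: "open S" "x0 \<in> S" and "\<eta> > 0"
  shows "\<exists>r>0. ball x0 r \<subseteq> S \<and> (\<forall>x\<in>ball x0 r. \<forall>y\<in>ball x0 r.
    \<bar>f x - f y - (\<Sum>i\<in>Basis. ((x - y) \<bullet> i) * f' i x0)\<bar> \<le> \<eta> * norm (x - y))"
proof -
  define e where "e = \<eta> / DIM('a)"
  have e: "e > 0" using \<open>\<eta> > 0\<close> by (simp add: e_def)
  have "\<forall>\<^sub>F x in nhds x0. \<forall>i\<in>Basis. dist (f' i x) (f' i x0) < e"
  proof (rule eventually_ball_finite)
    show "\<forall>i\<in>Basis. \<forall>\<^sub>F x in nhds x0. dist (f' i x) (f' i x0) < e"
    proof
      fix i :: 'a assume "i \<in> Basis"
      then have "isCont (f' i) x0" using cont S continuous_on_eq_continuous_at by blast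
      then show "\<forall>\<^sub>F x in nhds x0. dist (f' i x) (f' i x0) < e"
        using e unfolding isCont_def tendsto_at_iff_tendsto_nhds by (rule tendstoD)
    qed
  qed simp
  moreover have "\<forall>\<^sub>F x in nhds x0. x \<in> S" using S eventually_nhds_in_open by blast
  ultimately have "\<forall>\<^sub>F x in nhds x0. x \<in> S \<and> (\<forall>i\<in>Basis. dist (f' i x) (f' i x0) < e)"
    by eventually_elim auto
  then obtain r where r: "r > 0" and "\<forall>x. dist x x0 < r \<longrightarrow> x \<in> S \<and> (\<forall>i\<in>Basis. dist (f' i x) (f' i x0) < e)"
    unfolding eventually_nhds_metric by blast
  then have rS: "\<And>x. x \<in> ball x0 r \<Longrightarrow> x \<in> S"
    and re: "\<And>x i. x \<in> ball x0 r \<Longrightarrow> i \<in> Basis \<Longrightarrow> \<bar>f' i x - f' i x0\<bar> < e"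
    by (auto simp: dist_commute dist_real_def)
  define g where "g z = f z - (\<Sum>i\<in>Basis. (z \<bullet> i) * f' i x0)" for z
  have "norm (g x - g y) \<le> \<eta> * norm (x - y)" if "x \<in> ball x0 r" "y \<in> ball x0 r" for x y
  proof (rule differentiable_bound[OF convex_ball, where f' = "\<lambda>z h. \<Sum>i\<in>Basis. (h \<bullet> i) * (f' i z - f' i x0)"])
    fix z assume z: "z \<in> ball x0 r"
    have "((\<lambda>z. \<Sum>i\<in>Basis. (z \<bullet> i) * f' i x0) has_derivative (\<lambda>h. \<Sum>i\<in>Basis. (h \<bullet> i) * f' i x0)) (at z)"
      by (auto intro!: derivative_eq_intros)
    from has_derivative_diff[OF f'[OF rS[OF z]] this]
    have "(g has_derivative (\<lambda>h. \<Sum>i\<in>Basis. (h \<bullet> i) * (f' i z - f' i x0))) (at z)"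
      unfolding g_def right_diff_distrib sum_subtractf .
    then show "(g has_derivative (\<lambda>h. \<Sum>i\<in>Basis. (h \<bullet> i) * (f' i z - f' i x0))) (at z within ball x0 r)"
      by (rule has_derivative_at_withinI)
    show "onorm (\<lambda>h. \<Sum>i\<in>Basis. (h \<bullet> i) * (f' i z - f' i x0)) \<le> \<eta>"
    proof (rule onorm_le)
      fix h :: 'a
      have "norm (\<Sum>i\<in>Basis. (h \<bullet> i) * (f' i z - f' i x0)) \<le> (\<Sum>i\<in>(Basis::'a set). norm h * e)"
      proof (rule sum_norm_le)
        fix i :: 'a assume "i \<in> Basis"
        then show "norm ((h \<bullet> i) * (f' i z - f' i x0)) \<le> norm h * e"
          unfolding norm_mult using re[OF z] Basis_le_norm[of i h] by (intro mult_mono) (auto simp: less_imp_le)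
      qed
      also have "\<dots> = \<eta> * norm h" by (simp add: e_def)
      finally show "norm (\<Sum>i\<in>Basis. (h \<bullet> i) * (f' i z - f' i x0)) \<le> \<eta> * norm h" .
    qed
  qed (use that in auto)
  moreover have "g x - g y = f x - f y - (\<Sum>i\<in>Basis. ((x - y) \<bullet> i) * f' i x0)" for x y
    by (simp add: g_def inner_diff_left left_diff_distrib sum_subtractf)
  ultimately show ?thesis using r rS by (intro exI[of _ r]) auto
qed

lemma CK1_locally_Lipschitz:
  assumes "CK 1 S f" "open S" "x0 \<in> S"
  shows "\<exists>r>0. \<exists>L. ball x0 r \<subseteq> S \<and> (\<forall>x\<in>ball x0 r. \<forall>y\<in>ball x0 r. \<bar>f x - f y\<bar> \<le> L * norm (x - y))"
proof -
  obtain f' where f': "\<And>x. x \<in> S \<Longrightarrow> (f has_derivative (\<lambda>h. \<Sum>i\<in>Basis. (h \<bullet> i) * f' i x)) (at x)"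
    "\<And>i. i \<in> Basis \<Longrightarrow> continuous_on S (f' i)" using assms(1) by (auto simp: One_nat_def)
  obtain r where r: "r > 0" "ball x0 r \<subseteq> S" "\<And>x y. x\<in>ball x0 r \<Longrightarrow> y\<in>ball x0 r \<Longrightarrow>
    \<bar>f x - f y - (\<Sum>i\<in>Basis. ((x - y) \<bullet> i) * f' i x0)\<bar> \<le> 1 * norm (x - y)"
    using C1_strictly_differentiable[OF f' assms(2,3), of 1] by auto
  define L where "L = 1 + (\<Sum>i\<in>Basis. \<bar>f' i x0\<bar>)"
  have "\<bar>f x - f y\<bar> \<le> L * norm (x - y)" if "x\<in>ball x0 r" "y\<in>ball x0 r" for x y
  proof -
    have "\<bar>\<Sum>i\<in>Basis. ((x - y) \<bullet> i) * f' i x0\<bar> \<le> (\<Sum>i\<in>Basis. norm (x - y) * \<bar>f' i x0\<bar>)"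
      by (rule order_trans[OF sum_abs]) (auto intro!: sum_mono mult_mono Basis_le_norm simp: abs_mult)
    then show ?thesis using r(3)[OF that] by (simp add: L_def algebra_simps sum_distrib_left)
  qed
  then show ?thesis using r by blast
qed

lemma CK1_locally_Lipschitz_vector:
  fixes F :: "'a::euclidean_space \<Rightarrow> 'b::euclidean_space"
  assumes F: "\<And>i. i \<in> Basis \<Longrightarrow> CK 1 S (\<lambda>x. F x \<bullet> i)" and S: "open S" "x0 \<in> S"
  shows "\<exists>r>0. \<exists>L. ball x0 r \<subseteq> S \<and> (\<forall>x\<in>ball x0 r. \<forall>y\<in>ball x0 r. norm (F x - F y) \<le> L * norm (x - y))"
proof -
  have "\<exists>r L. i \<in> Basis \<longrightarrow> r > 0 \<and> ball x0 r \<subseteq> S \<and>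
      (\<forall>x\<in>ball x0 r. \<forall>y\<in>ball x0 r. \<bar>F x \<bullet> i - F y \<bullet> i\<bar> \<le> L * norm (x - y))" for i
    using CK1_locally_Lipschitz[OF F S, of i] by blast
  then obtain r L where rL: "\<And>i. i \<in> Basis \<Longrightarrow> r i > 0 \<and> ball x0 (r i) \<subseteq> S \<and>
      (\<forall>x\<in>ball x0 (r i). \<forall>y\<in>ball x0 (r i). \<bar>F x \<bullet> i - F y \<bullet> i\<bar> \<le> L i * norm (x - y))"
    by metis
  define r0 where "r0 = Min (r ` Basis)"
  have r0: "r0 > 0" "\<And>i. i \<in> Basis \<Longrightarrow> ball x0 r0 \<subseteq> ball x0 (r i)"
    using rL by (auto simp: r0_def)
  have "norm (F x - F y) \<le> (\<Sum>i\<in>Basis. L i) * norm (x - y)" if "x\<in>ball x0 r0" "y\<in>ball x0 r0" for x y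
  proof -
    have "norm (F x - F y) \<le> (\<Sum>i\<in>Basis. \<bar>(F x - F y) \<bullet> i\<bar>)" by (rule norm_le_l1)
    also have "\<dots> \<le> (\<Sum>i\<in>Basis. L i * norm (x - y))"
    proof (rule sum_mono)
      fix i :: 'b assume i: "i \<in> Basis"
      then have "x \<in> ball x0 (r i)" "y \<in> ball x0 (r i)" using r0(2)[OF i] that by blast+
      then show "\<bar>(F x - F y) \<bullet> i\<bar> \<le> L i * norm (x - y)"
        using rL[OF i] by (simp only: inner_diff_left)
    qed
    finally show ?thesis by (simp add: sum_distrib_right)
  qed
  moreover have "ball x0 r0 \<subseteq> S" using r0(2) rL nonempty_Basis by blast
  ultimately show ?thesis using r0(1) by blast
qed

section \<open>Transfer from \<open>Ck_on\<close> and \<open>smooth_on\<close>\<close>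

lemma Ck_on_imp_CK: "open S \<Longrightarrow> Ck_on n S f \<Longrightarrow> CK n S f"
proof (induction n arbitrary: f)
  case (Suc n)
  show ?case
  proof (rule CK_SucI[where f' = "\<lambda>i x. frechet_derivative f (at x) i"])
    fix x assume "x \<in> S"
    moreover have "f differentiable_on S" using Suc.prems(2) by simp
    ultimately have "f differentiable (at x)"
      using Suc.prems(1) at_within_open unfolding differentiable_on_def by metis
    then have d: "(f has_derivative frechet_derivative f (at x)) (at x)"
      by (simp add: frechet_derivative_works)
    then have l: "linear (frechet_derivative f (at x))" by (rule has_derivative_linear)
    have "frechet_derivative f (at x) h = (\<Sum>i\<in>Basis. (h \<bullet> i) * frechet_derivative f (at x) i)" for h
    proof -
      have "frechet_derivative f (at x) h = frechet_derivative f (at x) (\<Sum>i\<in>Basis. (h \<bullet> i) *\<^sub>R i)"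
        by (simp only: euclidean_representation)
      also have "\<dots> = (\<Sum>i\<in>Basis. (h \<bullet> i) * frechet_derivative f (at x) i)"
        by (simp add: linear_sum[OF l] linear_scale[OF l])
      finally show ?thesis .
    qed
    then have "frechet_derivative f (at x) = (\<lambda>h. \<Sum>i\<in>Basis. (h \<bullet> i) * frechet_derivative f (at x) i)" by blast
    with d show "(f has_derivative (\<lambda>h. \<Sum>i\<in>Basis. (h \<bullet> i) * frechet_derivative f (at x) i)) (at x)" by simp
  next
    fix i :: "real^2" assume "i \<in> Basis"
    then obtain k where "i = axis k 1" by (auto simp: Basis_vec_def)
    then have "(\<lambda>x. frechet_derivative f (at x) i) = partial k f" by (auto simp: partial_def)
    then show "CK n S (\<lambda>x. frechet_derivative f (at x) i)" using Suc by simp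
  qed
qed simp

lemma smooth_on_imp_CK: "open S \<Longrightarrow> smooth_on S f \<Longrightarrow> CK n S f"
  by (simp add: smooth_on_def Ck_on_imp_CK)

lemma smooth_on_partial: "smooth_on S f \<Longrightarrow> smooth_on S (partial i f)"
  unfolding smooth_on_def by (metis Ck_on.simps(2))

lemma smooth_on_has_derivative:
  assumes "open S" "smooth_on S f" "x \<in> S"
  shows "(f has_derivative (\<lambda>h. h \<bullet> grad f x)) (at x)"
proof -
  have "Ck_on (Suc 0) S f" using assms unfolding smooth_on_def by blast
  then have "f differentiable_on S" by simp
  then have "f differentiable (at x)"
    using assms(1,3) at_within_open unfolding differentiable_on_def by metis
  then have d: "(f has_derivative frechet_derivative f (at x)) (at x)"
    by (simp add: frechet_derivative_works)
  then have l: "linear (frechet_derivative f (at x))" by (rule has_derivative_linear)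
  have "frechet_derivative f (at x) h = h \<bullet> grad f x" for h
  proof -
    have "h = h $ 1 *\<^sub>R axis 1 1 + h $ 2 *\<^sub>R axis 2 1"
      by (simp add: vec_eq_iff forall_2 axis_def)
    then have "frechet_derivative f (at x) h = frechet_derivative f (at x) (h $ 1 *\<^sub>R axis 1 1 + h $ 2 *\<^sub>R axis 2 1)"
      by simp
    also have "\<dots> = h \<bullet> grad f x"
      by (simp add: linear_add[OF l] linear_scale[OF l] grad_def partial_def inner_vec_def sum_2)
    finally show ?thesis .
  qed
  then have "frechet_derivative f (at x) = (\<lambda>h. h \<bullet> grad f x)" by blast
  with d show ?thesis by simp
qed

section \<open>Uniqueness and a priori bounds for the dipole dynamics\<close>

text \<open>Inversion followed by a quarter turn, up to the factor \<open>1 / pi\<close>: the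
  interaction velocity that both vortices share, with \<open>z\<close> pointing from the second to
  the first.\<close>

definition vortex :: "real^2 \<Rightarrow> real^2" where
  "vortex z = (1 / pi) *\<^sub>R (perp z /\<^sub>R (norm z)\<^sup>2)"

definition dipole_field :: "(real^2 \<Rightarrow> real) \<Rightarrow> (real^2) \<times> (real^2) \<Rightarrow> (real^2) \<times> (real^2)" where
  "dipole_field Q X = (vortex (fst X - snd X) + perp_grad Q (fst X), vortex (fst X - snd X) - perp_grad Q (snd X))"

definition off_diagonal :: "((real^2) \<times> (real^2)) set" where
  "off_diagonal = {X. fst X \<noteq> snd X}"

lemma open_off_diagonal: "open off_diagonal"
  unfolding off_diagonal_def by (intro open_Collect_neq continuous_intros)

lemma norm_sq_2: "(norm (z :: real^2))\<^sup>2 = z $ 1 * z $ 1 + z $ 2 * z $ 2"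
  by (simp add: power2_norm_eq_inner inner_vec_def sum_2)

lemma vortex_nth:
  "vortex z $ 1 = z $ 2 * inverse (pi * (z $ 1 * z $ 1 + z $ 2 * z $ 2))"
  "vortex z $ 2 = - (z $ 1 * inverse (pi * (z $ 1 * z $ 1 + z $ 2 * z $ 2)))"
  by (simp_all add: vortex_def perp_def norm_sq_2 divide_simps)

lemma perp_grad_nth: "perp_grad Q x $ 1 = partial 2 Q x" "perp_grad Q x $ 2 = - partial 1 Q x"
  by (simp_all add: perp_grad_def)

lemma norm_sq_2_nonzero: "z \<noteq> 0 \<Longrightarrow> pi * (z $ 1 * z $ 1 + z $ 2 * z $ 2) \<noteq> 0" for z :: "real^2"
  using norm_sq_2[of z] by auto

lemma CK_vortex: "CK n (- {0}) (\<lambda>z. vortex z $ k)"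
proof -
  have l: "CK n S (\<lambda>z::real^2. z $ i)" for i S by (rule CK_linear) (rule bounded_linear_vec_nth)
  have "CK n (- {0}) (\<lambda>z::real^2. inverse (pi * (z $ 1 * z $ 1 + z $ 2 * z $ 2)))"
    using norm_sq_2_nonzero by (intro CK_inverse CK_mult CK_add CK_const l) auto
  then have "CK n (- {0}) (\<lambda>z. vortex z $ 1) \<and> CK n (- {0}) (\<lambda>z. vortex z $ 2)"
    unfolding vortex_nth by (intro conjI CK_mult CK_uminus l)
  then show ?thesis using exhaust_2[of k] by metis
qed

lemma CK_vortex_difference: "CK n off_diagonal (\<lambda>X. vortex (fst X - snd X) $ k)"
  by (rule CK_compose_linear[OF _ _ CK_vortex, where L = "\<lambda>X. fst X - snd X"])
    (auto simp: off_diagonal_def intro!: bounded_linear_sub bounded_linear_fst bounded_linear_snd)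

lemma CK_perp_grad: "smooth_on UNIV Q \<Longrightarrow> CK n UNIV (\<lambda>x. perp_grad Q x $ k)"
  using exhaust_2[of k] CK_uminus[OF smooth_on_imp_CK[OF open_UNIV smooth_on_partial[of UNIV Q 1]], of n]
    smooth_on_imp_CK[OF open_UNIV smooth_on_partial[of UNIV Q 2], of n]
  by (auto simp: perp_grad_nth)

lemma CK_compose_fst: "CK n S f \<Longrightarrow> fst ` T \<subseteq> S \<Longrightarrow> CK n T (\<lambda>X. f (fst X))"
  by (rule CK_compose_linear[OF bounded_linear_fst])

lemma CK_compose_snd: "CK n S f \<Longrightarrow> snd ` T \<subseteq> S \<Longrightarrow> CK n T (\<lambda>X. f (snd X))"
  by (rule CK_compose_linear[OF bounded_linear_snd])

lemma CK_dipole_field: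
  assumes "smooth_on UNIV Q" "i \<in> Basis"
  shows "CK n off_diagonal (\<lambda>X. dipole_field Q X \<bullet> i)"
proof -
  have 1: "CK n off_diagonal (\<lambda>X. (vortex (fst X - snd X) + perp_grad Q (fst X)) $ k)" for k
    using CK_add[OF CK_vortex_difference CK_compose_fst[OF CK_perp_grad[OF assms(1)] subset_UNIV]] by simp
  have 2: "CK n off_diagonal (\<lambda>X. (vortex (fst X - snd X) - perp_grad Q (snd X)) $ k)" for k
    using CK_diff[OF CK_vortex_difference CK_compose_snd[OF CK_perp_grad[OF assms(1)] subset_UNIV]] by simp
  from assms(2) consider k where "i = (axis k 1, 0)" | k where "i = (0, axis k 1)"
    by (auto simp: Basis_prod_def Basis_vec_def)
  then show ?thesis
    by cases (use 1 2 in \<open>auto simp: dipole_field_def inner_axis simp del: vector_add_component vector_minus_component\<close>)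
qed

lemma dipole_solution_iff:
  "dipole_solution Q x y J ap am \<longleftrightarrow>
    open J \<and> is_interval J \<and> 0 \<in> J \<and> ap 0 = x \<and> am 0 = y \<and>
    (\<forall>s\<in>J. (ap s, am s) \<in> off_diagonal \<and>
      ((\<lambda>s. (ap s, am s)) has_vector_derivative dipole_field Q (ap s, am s)) (at s))"
proof -
  have "((\<lambda>s. (ap s, am s)) has_vector_derivative (u, v)) (at s) \<longleftrightarrow>
      (ap has_vector_derivative u) (at s) \<and> (am has_vector_derivative v) (at s)" for u v s
  proof
    assume a: "((\<lambda>s. (ap s, am s)) has_vector_derivative (u, v)) (at s)"
    have "((\<lambda>s. fst (ap s, am s)) has_vector_derivative fst (u, v)) (at s)"
      "((\<lambda>s. snd (ap s, am s)) has_vector_derivative snd (u, v)) (at s)"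
      using bounded_linear.has_vector_derivative[OF bounded_linear_fst a]
        bounded_linear.has_vector_derivative[OF bounded_linear_snd a] .
    then show "(ap has_vector_derivative u) (at s) \<and> (am has_vector_derivative v) (at s)" by simp
  qed (auto intro: has_vector_derivative_Pair)
  then show ?thesis
    unfolding dipole_solution_def dipole_field_def off_diagonal_def vortex_def by auto
qed

text \<open>The coincidence set is clopen in the interval. For openness: on a short interval around
  a coincidence time, the maximum of \<open>norm (D s)\<close> is at most half of itself.\<close>

lemma locally_Lipschitz_ode_unique:
  fixes F :: "'a::euclidean_space \<Rightarrow> 'a"
  assumes Lip: "\<And>z. z \<in> S \<Longrightarrow> \<exists>r>0. \<exists>L. ball z r \<subseteq> S \<and> (\<forall>x\<in>ball z r. \<forall>y\<in>ball z r. norm (F x - F y) \<le> L * norm (x - y))"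
    and J: "open J" "is_interval J" "s0 \<in> J" "s \<in> J"
    and X: "\<And>s. s \<in> J \<Longrightarrow> X s \<in> S" "\<And>s. s \<in> J \<Longrightarrow> (X has_vector_derivative F (X s)) (at s)"
    and Y: "\<And>s. s \<in> J \<Longrightarrow> Y s \<in> S" "\<And>s. s \<in> J \<Longrightarrow> (Y has_vector_derivative F (Y s)) (at s)"
    and init: "X s0 = Y s0"
  shows "X s = Y s"
proof -
  define D where "D s = X s - Y s" for s
  have contX: "isCont X s" and contY: "isCont Y s" if "s \<in> J" for s
    using X(2) Y(2) that has_vector_derivative_continuous by blast+
  have contD: "continuous_on J D"
    unfolding D_def by (intro continuous_at_imp_continuous_on ballI continuous_intros contX contY)
  define A where "A = {s\<in>J. D s = 0}"
  have "closedin (top_of_set J) A"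
    unfolding A_def by (rule continuous_closedin_preimage_constant[OF contD])
  moreover have "open A"
  proof (rule openI)
    fix t assume "t \<in> A"
    then have t: "t \<in> J" "X t = Y t" by (auto simp: A_def D_def)
    obtain r L where r: "r > 0" "\<And>x y. x\<in>ball (X t) r \<Longrightarrow> y\<in>ball (X t) r \<Longrightarrow> norm (F x - F y) \<le> L * norm (x - y)"
      using Lip[OF X(1)[OF t(1)]] by blast
    have "\<forall>\<^sub>F s in nhds t. X s \<in> ball (X t) r" "\<forall>\<^sub>F s in nhds t. Y s \<in> ball (X t) r"
      using contX[OF t(1)] contY[OF t(1)] t(2) r(1)
      unfolding isCont_def tendsto_at_iff_tendsto_nhds
      by (auto intro!: topological_tendstoD simp del: mem_ball)
    moreover have "\<forall>\<^sub>F s in nhds t. s \<in> J" using J(1) t(1) by (rule eventually_nhds_in_open)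
    ultimately have "\<forall>\<^sub>F s in nhds t. s \<in> J \<and> X s \<in> ball (X t) r \<and> Y s \<in> ball (X t) r"
      by eventually_elim auto
    then obtain e where e: "e > 0"
      and eJ: "\<And>s. dist s t < e \<Longrightarrow> s \<in> J \<and> X s \<in> ball (X t) r \<and> Y s \<in> ball (X t) r"
      unfolding eventually_nhds_metric by blast
    \<comment> \<open>\<open>e / 2\<close> keeps the closed interval \<open>K\<close> where the
      Lipschitz bound holds; the second entry gives
      \<open>\<bar>L\<bar> * \<bar>s1 - t\<bar> \<le> 1 / 2\<close>.\<close>
    define \<eta> where "\<eta> = min (e / 2) (1 / (2 * (\<bar>L\<bar> + 1)))"
    have \<eta>: "\<eta> > 0" using e by (auto simp: \<eta>_def)
    define K where "K = {t - \<eta>..t + \<eta>}"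
    have KJ: "dist s t < e" if "s \<in> K" for s
      using that e by (auto simp: K_def dist_real_def \<eta>_def)
    have "compact K" "K \<noteq> {}" using \<eta> by (auto simp: K_def)
    moreover have "continuous_on K (\<lambda>s. norm (D s))"
      using KJ eJ by (intro continuous_on_norm continuous_on_subset[OF contD]) blast
    ultimately obtain s1 where s1: "s1 \<in> K" "\<And>s. s \<in> K \<Longrightarrow> norm (D s) \<le> norm (D s1)"
      using continuous_attains_sup[of K "\<lambda>s. norm (D s)"] by blast
    have tK: "t \<in> K" using \<eta> by (auto simp: K_def)
    have "norm (D s1 - D t) \<le> (\<bar>L\<bar> * norm (D s1)) * norm (s1 - t)"
    proof (rule differentiable_bound[of K D "\<lambda>s h. h *\<^sub>R (F (X s) - F (Y s))"])
      fix s assume s: "s \<in> K"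
      have sJ: "s \<in> J" "X s \<in> ball (X t) r" "Y s \<in> ball (X t) r" using eJ[OF KJ[OF s]] by auto
      show "(D has_derivative (\<lambda>h. h *\<^sub>R (F (X s) - F (Y s)))) (at s within K)"
        using has_vector_derivative_diff[OF X(2)[OF sJ(1)] Y(2)[OF sJ(1)]]
        unfolding D_def has_vector_derivative_def by (rule has_derivative_at_withinI)
      have "norm (F (X s) - F (Y s)) \<le> \<bar>L\<bar> * norm (D s)"
        using r(2)[OF sJ(2,3)] unfolding D_def
        by (smt (verit) mult_right_mono norm_ge_zero)
      also have "\<dots> \<le> \<bar>L\<bar> * norm (D s1)" by (intro mult_left_mono s1(2) s) auto
      finally show "onorm (\<lambda>h. h *\<^sub>R (F (X s) - F (Y s))) \<le> \<bar>L\<bar> * norm (D s1)"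
        by (intro onorm_le) (simp add: mult.commute[of _ "\<bar>_\<bar>"] mult_left_mono)
    qed (use s1(1) tK in \<open>auto simp: K_def\<close>)
    also have "D t = 0" using t by (simp add: D_def)
    finally have "norm (D s1) \<le> norm (D s1) * (\<bar>L\<bar> * \<bar>s1 - t\<bar>)" by (simp add: mult_ac)
    moreover have "\<bar>L\<bar> * \<bar>s1 - t\<bar> \<le> 1 / 2"
    proof -
      have "\<bar>s1 - t\<bar> \<le> 1 / (2 * (\<bar>L\<bar> + 1))" using s1(1) by (auto simp: K_def \<eta>_def)
      then have "(\<bar>L\<bar> + 1) * \<bar>s1 - t\<bar> \<le> (\<bar>L\<bar> + 1) * (1 / (2 * (\<bar>L\<bar> + 1)))"
        by (intro mult_left_mono) auto
      also have "\<dots> = 1 / 2" by (simp add: divide_simps)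
      finally have "(\<bar>L\<bar> + 1) * \<bar>s1 - t\<bar> \<le> 1 / 2" .
      moreover have "\<bar>L\<bar> * \<bar>s1 - t\<bar> \<le> (\<bar>L\<bar> + 1) * \<bar>s1 - t\<bar>"
        by (intro mult_right_mono) auto
      ultimately show ?thesis by (rule order_trans[rotated])
    qed
    then have "norm (D s1) * (\<bar>L\<bar> * \<bar>s1 - t\<bar>) \<le> norm (D s1) * (1 / 2)"
      by (intro mult_left_mono) auto
    ultimately have D0: "norm (D s1) = 0" using norm_ge_zero[of "D s1"] by linarith
    have "ball t \<eta> \<subseteq> A"
    proof
      fix s assume "s \<in> ball t \<eta>"
      then have "s \<in> K" by (auto simp: K_def dist_real_def)
      then show "s \<in> A" using s1(2)[of s] D0 eJ[OF KJ] by (auto simp: A_def)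
    qed
    then show "\<exists>e>0. ball t e \<subseteq> A" using \<eta> by blast
  qed
  then have "openin (top_of_set J) A" by (intro open_subset) (auto simp: A_def)
  moreover have "s0 \<in> A" using J init by (auto simp: A_def D_def)
  moreover have "connected J" using J(2) is_interval_connected_1 by blast
  ultimately have "A = J" unfolding connected_clopen by blast
  then show ?thesis using J(4) by (auto simp: A_def D_def)
qed

lemma dipole_solution_unique:
  assumes Q: "smooth_on UNIV Q" and 1: "dipole_solution Q x y J ap am" and 2: "dipole_solution Q x y J' ap' am'"
    and s: "s \<in> J" "s \<in> J'"
  shows "ap s = ap' s" "am s = am' s"
proof -
  have "(ap s, am s) = (ap' s, am' s)"
  proof (rule locally_Lipschitz_ode_unique[where S = off_diagonal and F = "dipole_field Q" and J = "J \<inter> J'"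
      and X = "\<lambda>s. (ap s, am s)" and Y = "\<lambda>s. (ap' s, am' s)" and ?s0.0 = 0])
    fix z assume "z \<in> off_diagonal"
    then show "\<exists>r>0. \<exists>L. ball z r \<subseteq> off_diagonal \<and> (\<forall>x\<in>ball z r. \<forall>y\<in>ball z r.
        norm (dipole_field Q x - dipole_field Q y) \<le> L * norm (x - y))"
      by (intro CK1_locally_Lipschitz_vector CK_dipole_field Q open_off_diagonal)
  qed (use 1 2 s in \<open>auto simp: dipole_solution_iff is_interval_Int\<close>)
  then show "ap s = ap' s" "am s = am' s" by auto
qed

text \<open>Uniqueness turns the description operators into the values of any solution at hand, so
  that later proofs can work with \<open>ap\<close> and \<open>am\<close>.\<close>

lemma dipole_solution_a:
  assumes Q: "smooth_on UNIV Q" and sol: "dipole_solution Q x y J ap am" and s: "s \<in> J"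
  shows "a_plus Q x y s = ap s" "a_minus Q x y s = am s" "s \<in> life Q x y"
proof -
  show "a_plus Q x y s = ap s" unfolding a_plus_def
    using sol s dipole_solution_unique(1)[OF Q _ sol _ s] by (intro the_equality) blast+
  show "a_minus Q x y s = am s" unfolding a_minus_def
    using sol s dipole_solution_unique(2)[OF Q _ sol _ s] by (intro the_equality) blast+
  show "s \<in> life Q x y" using sol s by (auto simp: life_def)
qed

lemma life_iff: "s \<in> life Q x y \<longleftrightarrow> (\<exists>J ap am. dipole_solution Q x y J ap am \<and> s \<in> J)"
  by (auto simp: life_def)

section \<open>Mean value bounds along curves\<close>

text \<open>The mean value inequality for \<open>X s - s *\<^sub>R v\<close>. The bound is asked on
  the open interval because \<open>curve_stays_in_ball\<close> knows it before, but not at, the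
  first time outside the ball.\<close>

lemma curve_displacement:
  fixes X :: "real \<Rightarrow> 'a::real_normed_vector"
  assumes t: "t \<ge> 0" and X: "\<And>s. s \<in> {0..t} \<Longrightarrow> (X has_vector_derivative G s) (at s)"
    and bnd: "\<And>s. 0 < s \<Longrightarrow> s < t \<Longrightarrow> norm (G s - v) \<le> \<eta>"
  shows "norm (X t - X 0 - t *\<^sub>R v) \<le> \<eta> * t"
proof (cases "t = 0")
  case False
  have "norm ((X t - t *\<^sub>R v) - (X 0 - 0 *\<^sub>R v)) \<le> \<eta> * t - \<eta> * 0"
  proof (rule differentiable_bound_general[where f = "\<lambda>s. X s - s *\<^sub>R v" and f' = "\<lambda>s. G s - v" and \<phi>' = "\<lambda>s. \<eta>"])
    show "continuous_on {0..t} (\<lambda>s. X s - s *\<^sub>R v)"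
      using X has_vector_derivative_continuous
      by (intro continuous_at_imp_continuous_on ballI continuous_intros) blast
    fix s assume "0 < s" "s < t"
    then show "((\<lambda>s. X s - s *\<^sub>R v) has_vector_derivative G s - v) (at s)"
      using X[of s] by (auto intro!: derivative_eq_intros)
    show "((\<lambda>s. \<eta> * s) has_vector_derivative \<eta>) (at s)"
      by (auto intro!: derivative_eq_intros simp flip: has_real_derivative_iff_has_vector_derivative)
  qed (use False t bnd in \<open>auto intro!: continuous_intros\<close>)
  then show ?thesis by (simp add: algebra_simps)
qed simp

text \<open>Up to the first time \<open>s1\<close> outside the ball the speed is at most
  \<open>M\<close>, and the curve cannot yet have covered the distance needed to get out. Hence a
  bound on \<open>G\<close> inside the ball is enough.\<close>

lemma curve_stays_in_ball:
  fixes X :: "real \<Rightarrow> 'a::real_normed_vector"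
  assumes X: "\<And>s. s \<in> {0..t} \<Longrightarrow> (X has_vector_derivative G s) (at s)"
    and bnd: "\<And>s. s \<in> {0..t} \<Longrightarrow> X s \<in> ball x0 r \<Longrightarrow> norm (G s) \<le> M"
    and M: "M \<ge> 0" and small: "norm (X 0 - x0) + t * M < r" and s: "s \<in> {0..t}"
  shows "X s \<in> ball x0 r"
proof (rule ccontr)
  assume "X s \<notin> ball x0 r"
  define B where "B = {s\<in>{0..t}. r \<le> norm (X s - x0)}"
  have sB: "s \<in> B" using \<open>X s \<notin> ball x0 r\<close> s by (auto simp: B_def dist_norm norm_minus_commute)
  have "continuous_on {0..t} X"
    using X has_vector_derivative_continuous by (intro continuous_at_imp_continuous_on ballI) blast
  then have "closedin (top_of_set {0..t}) ({0..t} \<inter> (\<lambda>s. norm (X s - x0)) -` {r..})"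
    by (intro continuous_closedin_preimage continuous_intros) auto
  moreover have "{0..t} \<inter> (\<lambda>s. norm (X s - x0)) -` {r..} = B" by (auto simp: B_def)
  ultimately have "compact B" using closedin_compact[of "{0..t}"] by simp
  then obtain s1 where s1: "s1 \<in> B" "\<And>s. s \<in> B \<Longrightarrow> s1 \<le> s"
    using compact_attains_inf[of B] sB by blast
  have t1: "0 \<le> s1" "s1 \<le> t" using s1(1) by (auto simp: B_def)
  have "norm (X s1 - X 0 - s1 *\<^sub>R 0) \<le> M * s1"
  proof (rule curve_displacement[OF t1(1) X])
    fix u assume u: "0 < u" "u < s1"
    then have "u \<notin> B" using s1(2) by force
    then have "X u \<in> ball x0 r" using u t1 by (auto simp: B_def dist_norm norm_minus_commute)
    then show "norm (G u - 0) \<le> M" using bnd[of u] u t1 by simp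
  qed (use t1 in auto)
  then have "norm (X s1 - x0) \<le> norm (X 0 - x0) + M * s1"
    using norm_triangle_ineq[of "X s1 - X 0" "X 0 - x0"] by simp
  also have "\<dots> \<le> norm (X 0 - x0) + t * M" using t1 mult_left_mono[OF t1(2) M] by (simp add: mult.commute)
  finally show False using small s1(1) by (auto simp: B_def)
qed

section \<open>Metric regularity of two equations in the plane\<close>

text \<open>\<open>k\<close> is the Lie derivative of \<open>f\<close> along \<open>F\<close>. With
  the normal speed for \<open>f\<close> it becomes the second derivative of \<open>\<rho>\<close>
  along trajectories.\<close>

lemma CK_derivative_along_field:
  fixes F :: "'a::euclidean_space \<Rightarrow> 'a"
  assumes f: "CK (Suc n) S f" and F: "\<And>i. i \<in> Basis \<Longrightarrow> CK n S (\<lambda>X. F X \<bullet> i)"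
  obtains k where "CK n S k"
    and "\<And>Z s. (Z has_vector_derivative F (Z s)) (at s) \<Longrightarrow> Z s \<in> S \<Longrightarrow>
      ((\<lambda>s. f (Z s)) has_real_derivative k (Z s)) (at s)"
proof -
  obtain f' where f': "\<And>x. x \<in> S \<Longrightarrow> (f has_derivative (\<lambda>h. \<Sum>i\<in>Basis. (h \<bullet> i) * f' i x)) (at x)"
    "\<And>i. i \<in> Basis \<Longrightarrow> CK n S (f' i)" using CK_SucE[OF f] by blast
  define k where "k X = (\<Sum>i\<in>Basis. (F X \<bullet> i) * f' i X)" for X
  show thesis
  proof
    show "CK n S k" unfolding k_def by (intro CK_sum CK_mult F f'(2))
    fix Z s assume Z: "(Z has_vector_derivative F (Z s)) (at s)" "Z s \<in> S"
    have "((\<lambda>s. f (Z s)) has_derivative (\<lambda>h. \<Sum>i\<in>Basis. ((h *\<^sub>R F (Z s)) \<bullet> i) * f' i (Z s))) (at s)"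
      using has_derivative_compose[OF Z(1)[unfolded has_vector_derivative_def] f'(1)[OF Z(2)]] .
    moreover have "(\<lambda>h. \<Sum>i\<in>Basis. ((h *\<^sub>R F (Z s)) \<bullet> i) * f' i (Z s)) = (*) (k (Z s))"
      by (auto simp: k_def sum_distrib_left sum_distrib_right mult_ac fun_eq_iff)
    ultimately show "((\<lambda>s. f (Z s)) has_real_derivative k (Z s)) (at s)"
      by (simp add: has_field_derivative_def)
  qed
qed

lemma inner_2: "(x :: real^2) \<bullet> y = x $ 1 * y $ 1 + x $ 2 * y $ 2"
  by (simp add: inner_vec_def sum_2)

text \<open>A Newton iteration with the inverse Jacobian frozen at \<open>(p, q)\<close>, uniform in
  the parameter \<open>b\<close>. The bound of the distance by the residuals at \<open>a\<close>
  serves twice: to find starting points of short chords, and to compare a state with a tangential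
  one.\<close>

lemma two_equations_metrically_regular:
  fixes \<rho> :: "real^2 \<Rightarrow> real" and f :: "(real^2) \<times> 'b::metric_space \<Rightarrow> real"
  assumes \<rho>: "\<forall>\<eta>>0. \<exists>r>0. \<forall>x\<in>ball p r. \<forall>y\<in>ball p r. \<bar>\<rho> x - \<rho> y - (x - y) \<bullet> N\<bar> \<le> \<eta> * norm (x - y)"
    and f: "\<forall>\<eta>>0. \<exists>r>0. \<forall>x\<in>ball p r. \<forall>y\<in>ball p r. \<forall>b\<in>ball q r.
      \<bar>f (x, b) - f (y, b) - (x - y) \<bullet> d\<bar> \<le> \<eta> * norm (x - y)"
    and cont: "isCont (\<lambda>b. f (p, b)) q" and zero: "\<rho> p = 0" "f (p, q) = 0"
    and det: "N $ 1 * d $ 2 - N $ 2 * d $ 1 \<noteq> 0" and \<epsilon>: "\<epsilon> > 0"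
  obtains r C where "r > 0" "C > 0"
    and "\<And>a b r0 w0. a \<in> ball p r \<Longrightarrow> b \<in> ball q r \<Longrightarrow> \<bar>r0\<bar> < r \<Longrightarrow> \<bar>w0\<bar> < r \<Longrightarrow>
      \<exists>x\<in>ball p \<epsilon>. \<rho> x = r0 \<and> f (x, b) = w0 \<and> norm (a - x) \<le> C * (\<bar>\<rho> a - r0\<bar> + \<bar>f (a, b) - w0\<bar>)"
proof -
  define D where "D = N $ 1 * d $ 2 - N $ 2 * d $ 1"
  have D: "D \<noteq> 0" using det by (simp add: D_def)
  \<comment> \<open>Cramer's rule: \<open>B\<close> inverts the map sending \<open>h\<close> to
    \<open>(h \<bullet> N, h \<bullet> d)\<close>, whose determinant is \<open>D\<close>.\<close>
  define B :: "real \<Rightarrow> real \<Rightarrow> real^2" where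
    "B \<xi> \<zeta> = vector [(\<xi> * d $ 2 - \<zeta> * N $ 2) / D, (N $ 1 * \<zeta> - d $ 1 * \<xi>) / D]" for \<xi> \<zeta>
  have B_nth: "B \<xi> \<zeta> $ 1 = (\<xi> * d $ 2 - \<zeta> * N $ 2) / D" "B \<xi> \<zeta> $ 2 = (N $ 1 * \<zeta> - d $ 1 * \<xi>) / D" for \<xi> \<zeta>
    by (simp_all add: B_def)
  have B_inv: "B (h \<bullet> N) (h \<bullet> d) = h" for h
  proof -
    have "(h \<bullet> N) * d $ 2 - (h \<bullet> d) * N $ 2 = h $ 1 * D" "N $ 1 * (h \<bullet> d) - d $ 1 * (h \<bullet> N) = h $ 2 * D"
      by (simp_all add: inner_2 D_def algebra_simps)
    then show ?thesis using D by (simp add: vec_eq_iff forall_2 B_nth)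
  qed
  have B_diff: "B \<xi> \<zeta> - B \<xi>' \<zeta>' = B (\<xi> - \<xi>') (\<zeta> - \<zeta>')" for \<xi> \<zeta> \<xi>' \<zeta>'
    using D by (simp add: vec_eq_iff forall_2 B_nth field_simps)
  have B_zero: "B \<xi> \<zeta> = 0 \<Longrightarrow> \<xi> = 0 \<and> \<zeta> = 0" for \<xi> \<zeta>
  proof -
    assume "B \<xi> \<zeta> = 0"
    then have e: "\<xi> * d $ 2 - \<zeta> * N $ 2 = 0" "N $ 1 * \<zeta> - d $ 1 * \<xi> = 0"
      using D B_nth[of \<xi> \<zeta>] by (auto simp: divide_eq_0_iff)
    have "\<xi> * D = N $ 1 * (\<xi> * d $ 2 - \<zeta> * N $ 2) + N $ 2 * (N $ 1 * \<zeta> - d $ 1 * \<xi>)"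
      "\<zeta> * D = d $ 1 * (\<xi> * d $ 2 - \<zeta> * N $ 2) + d $ 2 * (N $ 1 * \<zeta> - d $ 1 * \<xi>)"
      by (simp_all add: D_def algebra_simps)
    then have "\<xi> * D = 0" "\<zeta> * D = 0" by (simp_all only: e mult_zero_right add_0)
    then show ?thesis using D by simp
  qed
  define K where "K = (\<bar>d $ 1\<bar> + \<bar>d $ 2\<bar> + \<bar>N $ 1\<bar> + \<bar>N $ 2\<bar>) / \<bar>D\<bar> + 1"
  have K: "K > 0" by (simp add: K_def add_nonneg_pos)
  have B_le: "norm (B \<xi> \<zeta>) \<le> K * (\<bar>\<xi>\<bar> + \<bar>\<zeta>\<bar>)" for \<xi> \<zeta>
  proof -
    have "norm (B \<xi> \<zeta>) \<le> \<bar>B \<xi> \<zeta> $ 1\<bar> + \<bar>B \<xi> \<zeta> $ 2\<bar>"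
      using norm_le_l1_cart[of "B \<xi> \<zeta>"] by (simp add: sum_2)
    also have "\<dots> = (\<bar>\<xi> * d $ 2 - \<zeta> * N $ 2\<bar> + \<bar>N $ 1 * \<zeta> - d $ 1 * \<xi>\<bar>) / \<bar>D\<bar>"
      by (simp add: B_nth add_divide_distrib)
    also have "\<dots> \<le> ((\<bar>d $ 1\<bar> + \<bar>d $ 2\<bar> + \<bar>N $ 1\<bar> + \<bar>N $ 2\<bar>) * (\<bar>\<xi>\<bar> + \<bar>\<zeta>\<bar>)) / \<bar>D\<bar>"
    proof (rule divide_right_mono)
      have "\<bar>\<xi> * d $ 2 - \<zeta> * N $ 2\<bar> \<le> \<bar>\<xi>\<bar> * \<bar>d $ 2\<bar> + \<bar>\<zeta>\<bar> * \<bar>N $ 2\<bar>"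
        "\<bar>N $ 1 * \<zeta> - d $ 1 * \<xi>\<bar> \<le> \<bar>N $ 1\<bar> * \<bar>\<zeta>\<bar> + \<bar>d $ 1\<bar> * \<bar>\<xi>\<bar>"
        using abs_triangle_ineq4 unfolding abs_mult[symmetric] by blast+
      moreover have "0 \<le> \<bar>\<xi>\<bar> * \<bar>N $ 1\<bar>" "0 \<le> \<bar>\<xi>\<bar> * \<bar>N $ 2\<bar>"
        "0 \<le> \<bar>\<zeta>\<bar> * \<bar>d $ 1\<bar>" "0 \<le> \<bar>\<zeta>\<bar> * \<bar>d $ 2\<bar>" by simp_all
      ultimately show "\<bar>\<xi> * d $ 2 - \<zeta> * N $ 2\<bar> + \<bar>N $ 1 * \<zeta> - d $ 1 * \<xi>\<bar> \<le>
          (\<bar>d $ 1\<bar> + \<bar>d $ 2\<bar> + \<bar>N $ 1\<bar> + \<bar>N $ 2\<bar>) * (\<bar>\<xi>\<bar> + \<bar>\<zeta>\<bar>)"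
        unfolding distrib_left distrib_right mult.commute[of "\<bar>\<xi>\<bar>"] mult.commute[of "\<bar>\<zeta>\<bar>"]
        by linarith
    qed simp
    also have "\<dots> \<le> K * (\<bar>\<xi>\<bar> + \<bar>\<zeta>\<bar>)" by (simp add: K_def algebra_simps)
    finally show ?thesis .
  qed
  \<comment> \<open>Two residuals, each with relative error \<open>\<eta>\<close>, are multiplied by
    \<open>K\<close>: this makes \<open>\<Lambda>\<close> a contraction with factor
    \<open>1 / 2\<close>.\<close>
  define \<eta> where "\<eta> = 1 / (4 * K)"
  have \<eta>: "\<eta> > 0" using K by (simp add: \<eta>_def)
  obtain r1 where r1: "r1 > 0" "\<And>x y. x\<in>ball p r1 \<Longrightarrow> y\<in>ball p r1 \<Longrightarrow> \<bar>\<rho> x - \<rho> y - (x - y) \<bullet> N\<bar> \<le> \<eta> * norm (x - y)"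
    using \<rho>[rule_format, OF \<eta>] by blast
  obtain r2 where r2: "r2 > 0" "\<And>x y b. x\<in>ball p r2 \<Longrightarrow> y\<in>ball p r2 \<Longrightarrow> b \<in> ball q r2 \<Longrightarrow>
      \<bar>f (x, b) - f (y, b) - (x - y) \<bullet> d\<bar> \<le> \<eta> * norm (x - y)"
    using f[rule_format, OF \<eta>] by blast
  define R where "R = min \<epsilon> (min r1 r2) / 2"
  have R: "R > 0" "R < \<epsilon>" "R < r1" "R < r2" using \<epsilon> r1(1) r2(1) by (auto simp: R_def)
  have "R / (6 * K) > 0" using R K by simp
  then obtain r3 where r3: "r3 > 0" "\<And>b. b \<in> ball q r3 \<Longrightarrow> \<bar>f (p, b)\<bar> < R / (6 * K)"
    using cont zero(2) unfolding continuous_at_eps_delta by (metis diff_0_right dist_commute dist_real_def mem_ball)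
  \<comment> \<open>\<open>R / (6 * K)\<close> bounds each of the three terms in the estimate of
    \<open>norm (\<Lambda> p - p)\<close>; their total \<open>R / 2\<close> lets
    \<open>\<Lambda>\<close> preserve the closed disc of radius \<open>R\<close>.\<close>
  define r where "r = min (min R r3) (R / (6 * K))"
  have r: "r > 0" "r \<le> R" "r \<le> r3" "r \<le> R / (6 * K)" using R r3 \<open>R / (6 * K) > 0\<close> by (auto simp: r_def)
  show thesis
  proof (rule that[of r "2 * K"])
    fix a b r0 w0 assume a: "a \<in> ball p r" and b: "b \<in> ball q r" and r0: "\<bar>r0\<bar> < r" and w0: "\<bar>w0\<bar> < r"
    define \<Lambda> where "\<Lambda> x = x - B (\<rho> x - r0) (f (x, b) - w0)" for x
    have lip: "norm (\<Lambda> x - \<Lambda> y) \<le> 1 / 2 * norm (x - y)" if "x \<in> cball p R" "y \<in> cball p R" for x y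
    proof -
      have x: "x \<in> ball p r1" "x \<in> ball p r2" "y \<in> ball p r1" "y \<in> ball p r2" "b \<in> ball q r2"
        using that b r R by auto
      have "\<Lambda> x - \<Lambda> y = (x - y) - (B (\<rho> x - r0) (f (x, b) - w0) - B (\<rho> y - r0) (f (y, b) - w0))"
        by (simp add: \<Lambda>_def)
      also have "\<dots> = B ((x - y) \<bullet> N) ((x - y) \<bullet> d) - B (\<rho> x - \<rho> y) (f (x, b) - f (y, b))"
        unfolding B_diff B_inv by simp
      also have "\<dots> = B ((x - y) \<bullet> N - (\<rho> x - \<rho> y)) ((x - y) \<bullet> d - (f (x, b) - f (y, b)))"
        by (rule B_diff)
      finally have "norm (\<Lambda> x - \<Lambda> y) \<le> K * (\<bar>(x - y) \<bullet> N - (\<rho> x - \<rho> y)\<bar> + \<bar>(x - y) \<bullet> d - (f (x, b) - f (y, b))\<bar>)"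
        using B_le by simp
      also have "\<dots> \<le> K * (\<eta> * norm (x - y) + \<eta> * norm (x - y))"
        using r1(2)[OF x(1,3)] r2(2)[OF x(2,4,5)] K
        by (intro mult_left_mono add_mono) (auto simp: abs_minus_commute)
      also have "\<dots> = 1 / 2 * norm (x - y)" using K by (simp add: \<eta>_def field_simps)
      finally show ?thesis .
    qed
    have pb: "norm (\<Lambda> p - p) \<le> R / 2"
    proof -
      have "norm (\<Lambda> p - p) = norm (B (- r0) (f (p, b) - w0))" using zero by (simp add: \<Lambda>_def)
      also have "\<dots> \<le> K * (\<bar>r0\<bar> + \<bar>f (p, b) - w0\<bar>)" using B_le[of "- r0"] by simp
      also have "\<dots> \<le> K * (R / (6 * K) + (R / (6 * K) + R / (6 * K)))"
        using r0 w0 r r3(2)[of b] b K by (intro mult_left_mono add_mono) auto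
      also have "\<dots> = R / 2" using K by (simp add: field_simps)
      finally show ?thesis .
    qed
    have "\<exists>!x\<in>cball p R. \<Lambda> x = x"
    proof (rule Banach_fix[where c = "1/2"])
      show "\<Lambda> ` cball p R \<subseteq> cball p R"
      proof
        fix y assume "y \<in> \<Lambda> ` cball p R"
        then obtain x where x: "x \<in> cball p R" "y = \<Lambda> x" by blast
        have "norm (\<Lambda> x - p) \<le> norm (\<Lambda> x - \<Lambda> p) + norm (\<Lambda> p - p)"
          using norm_triangle_ineq[of "\<Lambda> x - \<Lambda> p" "\<Lambda> p - p"] by simp
        also have "\<dots> \<le> 1 / 2 * norm (x - p) + R / 2"
          using R by (intro add_mono lip pb x) auto
        also have "\<dots> \<le> R" using x by (simp add: dist_norm norm_minus_commute)
        finally show "y \<in> cball p R" using x by (simp add: dist_norm norm_minus_commute)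
      qed
    qed (use R lip in \<open>auto simp: dist_norm compact_imp_complete simp del: mem_cball\<close>)
    then obtain x where x: "x \<in> cball p R" "\<Lambda> x = x" by blast
    have "B (\<rho> x - r0) (f (x, b) - w0) = 0" using x(2) by (simp add: \<Lambda>_def)
    then have eq: "\<rho> x = r0" "f (x, b) = w0" using B_zero by fastforce+
    \<comment> \<open>The first Newton step from \<open>a\<close> bounds the distance to the fixed
      point; absorbing the half on the right doubles \<open>K\<close>.\<close>
    have "norm (a - x) \<le> norm (a - \<Lambda> a) + norm (\<Lambda> a - \<Lambda> x)"
      using norm_triangle_ineq[of "a - \<Lambda> a" "\<Lambda> a - \<Lambda> x"] x(2) by simp
    also have "\<dots> \<le> K * (\<bar>\<rho> a - r0\<bar> + \<bar>f (a, b) - w0\<bar>) + 1 / 2 * norm (a - x)"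
      using a r by (intro add_mono lip x) (auto simp: \<Lambda>_def intro: B_le)
    finally have "norm (a - x) \<le> 2 * K * (\<bar>\<rho> a - r0\<bar> + \<bar>f (a, b) - w0\<bar>)" by simp
    then show "\<exists>x\<in>ball p \<epsilon>. \<rho> x = r0 \<and> f (x, b) = w0 \<and>
        norm (a - x) \<le> 2 * K * (\<bar>\<rho> a - r0\<bar> + \<bar>f (a, b) - w0\<bar>)"
      using eq x(1) R(2) by (intro bexI[of _ x]) auto
  qed (use r K in auto)
qed

section \<open>A tangential state with transversal normal speed\<close>

text \<open>The derivative of \<open>\<rho>\<close> along the path of the first vortex; its zeros
  over the boundary are the tangential states.\<close>

definition normal_speed :: "(real^2 \<Rightarrow> real) \<Rightarrow> (real^2 \<Rightarrow> real) \<Rightarrow> (real^2) \<times> (real^2) \<Rightarrow> real" where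
  "normal_speed \<rho> Q X = grad \<rho> (fst X) \<bullet> fst (dipole_field Q X)"

lemma grad_nth: "grad f x $ 1 = partial 1 f x" "grad f x $ 2 = partial 2 f x"
  by (simp_all add: grad_def)

lemma normal_speed_eq:
  "normal_speed \<rho> Q X =
    partial 1 \<rho> (fst X) * (vortex (fst X - snd X) $ 1 + partial 2 Q (fst X)) +
    partial 2 \<rho> (fst X) * (vortex (fst X - snd X) $ 2 - partial 1 Q (fst X))"
  by (simp add: normal_speed_def dipole_field_def inner_2 grad_nth perp_grad_nth)

lemma CK_normal_speed:
  assumes "open V" "smooth_on V \<rho>" "smooth_on UNIV Q"
  shows "CK n ({X. fst X \<in> V} \<inter> off_diagonal) (normal_speed \<rho> Q)"
proof -
  let ?S = "{X. fst X \<in> V} \<inter> off_diagonal"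
  have "CK n ?S (\<lambda>X. partial i \<rho> (fst X))" for i
    by (rule CK_compose_fst[OF smooth_on_imp_CK[OF assms(1) smooth_on_partial[OF assms(2)]]]) auto
  moreover have "CK n ?S (\<lambda>X. partial i Q (fst X))" for i
    by (rule CK_compose_fst[OF smooth_on_imp_CK[OF open_UNIV smooth_on_partial[OF assms(3)]]]) auto
  moreover have "CK n ?S (\<lambda>X. vortex (fst X - snd X) $ i)" for i
    by (rule CK_subset[OF CK_vortex_difference]) auto
  ultimately show ?thesis
    unfolding normal_speed_eq by (intro CK_add CK_mult CK_diff)
qed

lemma smooth_on_directional_derivative:
  assumes "open S" "smooth_on S f" "x \<in> S"
  shows "((\<lambda>t. f (x + t *\<^sub>R v)) has_real_derivative v \<bullet> grad f x) (at 0)"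
proof -
  have "((\<lambda>t. x + t *\<^sub>R v) has_derivative (\<lambda>t. t *\<^sub>R v)) (at 0)"
    by (auto intro!: derivative_eq_intros)
  moreover have "(f has_derivative (\<lambda>h. h \<bullet> grad f x)) (at (x + 0 *\<^sub>R v))"
    using smooth_on_has_derivative[OF assms] by simp
  ultimately have "((\<lambda>t. f (x + t *\<^sub>R v)) has_derivative (\<lambda>t. (t *\<^sub>R v) \<bullet> grad f x)) (at 0)"
    by (rule has_derivative_compose)
  moreover have "(\<lambda>t. (t *\<^sub>R v) \<bullet> grad f x) = (*) (v \<bullet> grad f x)" by (auto simp: fun_eq_iff)
  ultimately show ?thesis by (simp add: has_field_derivative_def)
qed

lemma vortex_directional_derivative:
  assumes D: "z $ 1 * z $ 1 + z $ 2 * z $ 2 = D" and "z \<noteq> 0"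
  shows "((\<lambda>t. vortex (z + t *\<^sub>R v) $ 1) has_real_derivative
      (v $ 2 * D - 2 * z $ 2 * (z \<bullet> v)) / (pi * D\<^sup>2)) (at 0)" (is ?A)
    and "((\<lambda>t. vortex (z + t *\<^sub>R v) $ 2) has_real_derivative
      (2 * z $ 1 * (z \<bullet> v) - v $ 1 * D) / (pi * D\<^sup>2)) (at 0)" (is ?B)
proof -
  have D0: "D \<noteq> 0" using norm_sq_2[of z] assms by auto
  have "((\<lambda>t. inverse (pi * ((z $ 1 + t * v $ 1) * (z $ 1 + t * v $ 1) + (z $ 2 + t * v $ 2) * (z $ 2 + t * v $ 2))))
      has_real_derivative - (2 * (z \<bullet> v)) / (pi * D\<^sup>2)) (at 0)"
    using D D0 by (auto intro!: derivative_eq_intros simp: inner_2 power2_eq_square divide_simps)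
  note inv = this
  have lin: "((\<lambda>t. z $ i + t * v $ i) has_real_derivative v $ i) (at 0)" for i
    by (auto intro!: derivative_eq_intros)
  show ?A
    unfolding vortex_nth vector_add_component vector_scaleR_component real_scaleR_def
    by (rule DERIV_cong[OF DERIV_mult[OF lin inv]]) (use D0 D in \<open>simp add: field_simps power2_eq_square\<close>)
  show ?B
    unfolding vortex_nth vector_add_component vector_scaleR_component real_scaleR_def
    by (rule DERIV_cong[OF DERIV_minus[OF DERIV_mult[OF lin inv]]]) (use D0 D in \<open>simp add: field_simps power2_eq_square\<close>)
qed

text \<open>Needed for the derivative of the normal speed, a quadratic in the parameter
  \<open>l\<close> below. \<open>L\<close> solves
  \<open>a * L = a + \<bar>b\<bar> + \<bar>c\<bar>\<close>, so that the square dominates from there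
  on.\<close>

lemma quadratic_eventually_positive:
  fixes a b c :: real
  assumes "a > 0"
  shows "\<exists>L\<ge>1. \<forall>x\<ge>L. a * x\<^sup>2 + b * x + c > 0"
proof (intro exI conjI allI impI)
  define L where "L = 1 + (\<bar>b\<bar> + \<bar>c\<bar>) / a"
  show "1 \<le> L" using assms by (simp add: L_def)
  fix x assume x: "x \<ge> L"
  then have x1: "x \<ge> 1" using \<open>1 \<le> L\<close> by simp
  have "a + \<bar>b\<bar> + \<bar>c\<bar> = a * L" using assms by (simp add: L_def field_simps)
  also have "\<dots> \<le> a * x" using x assms by simp
  finally have "(a + \<bar>b\<bar> + \<bar>c\<bar>) * x \<le> a * x * x" using x1 by (intro mult_right_mono) auto
  moreover have "\<bar>c\<bar> \<le> \<bar>c\<bar> * x" using x1 mult_left_mono[of 1 x "\<bar>c\<bar>"] by simp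
  moreover have "- (b * x) \<le> \<bar>b\<bar> * x" using x1 by (metis abs_ge_minus_self mult_minus_left mult_right_mono order_trans zero_le_one)
  moreover have "a * x > 0" using assms x1 by simp
  ultimately show "a * x\<^sup>2 + b * x + c > 0" by (simp add: power2_eq_square algebra_simps)
qed

text \<open>Writing \<open>q = p - z\<close>, the vortex velocity at \<open>p\<close> is an inversion of \<open>z\<close>. The second vortex is
  placed so that this velocity is \<open>l T + \<mu> N\<close>, where \<open>N\<close> is the outer normal and \<open>\<mu>\<close> cancels the
  normal component of the background flow; the derivative of the normal speed along \<open>T\<close> then
  grows like \<open>l\<^sup>2\<close>.\<close>

lemma exists_transversal_tangency:
  fixes p :: "real^2"
  assumes V: "open V" "smooth_on V \<rho>" "p \<in> V" and \<rho>: "\<rho> p = 0" "grad \<rho> p = N" "N \<noteq> 0"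
    and Q: "smooth_on UNIV Q" and G: "open G" "p \<in> G" and T: "T = vector [- N $ 2, N $ 1]"
  obtains q \<delta> where "q \<in> G" "q \<in> V" "q \<noteq> p" "\<rho> q > 0" "normal_speed \<rho> Q (p, q) = 0" "\<delta> > 0"
    "((\<lambda>t. normal_speed \<rho> Q (p + t *\<^sub>R T, q)) has_real_derivative \<delta>) (at 0)"
proof -
  have T_nth: "T $ 1 = - N $ 2" "T $ 2 = N $ 1" using T by simp_all
  define n where "n = (norm N)\<^sup>2"
  have n: "n > 0" "n = N $ 1 * N $ 1 + N $ 2 * N $ 2" using \<rho>(3) by (simp add: n_def) (simp only: n_def norm_sq_2)
  define g where "g = perp_grad Q p"
  have g_nth: "g $ 1 = partial 2 Q p" "g $ 2 = - partial 1 Q p" by (simp_all add: g_def perp_grad_nth)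
  define \<mu> where "\<mu> = - (N \<bullet> g) / n"
  define H where "H i = T \<bullet> grad (partial i \<rho>) p" for i
  define P where "P i = T \<bullet> grad (partial i Q) p" for i
  define b where "b = H 1 * T $ 1 + H 2 * T $ 2"
  define c where "c = H 1 * (\<mu> * N $ 1 + g $ 1) + H 2 * (\<mu> * N $ 2 + g $ 2) + N $ 1 * P 2 - N $ 2 * P 1 - pi * n\<^sup>2 * \<mu>\<^sup>2"
  obtain L where L: "L \<ge> 1" "\<And>x. x \<ge> L \<Longrightarrow> pi * n\<^sup>2 * x\<^sup>2 + b * x + c > 0"
    using quadratic_eventually_positive[of "pi * n\<^sup>2" b c] n(1) by (metis pi_gt_zero mult_pos_pos zero_less_power)
  obtain e where e: "e > 0" "ball p e \<subseteq> G \<inter> V"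
    using G V(1,3) by (meson IntI openE open_Int)
  have "(\<rho> has_derivative (\<lambda>h. h \<bullet> N)) (at p)" using smooth_on_has_derivative[OF V] \<rho>(2) by simp
  \<comment> \<open>Why a quarter: with \<open>norm (q - p) \<le> 2 * k * l * norm N\<close> below,
    the first-order error is at most half of the linear term \<open>k * l * n\<close>, and
    \<open>\<rho> q\<close> stays positive.\<close>
  then obtain e' where e': "e' > 0" "\<And>y. norm (y - p) < e' \<Longrightarrow>
      norm (\<rho> y - \<rho> p - (y - p) \<bullet> N) \<le> norm N / 4 * norm (y - p)"
    unfolding has_derivative_at_alt using \<rho>(3) by (metis divide_pos_pos zero_less_norm_iff zero_less_numeral)
  \<comment> \<open>Three demands: \<open>L\<close> makes the derivative \<open>\<delta>\<close>
    positive, \<open>\<bar>\<mu>\<bar>\<close> lets the normal direction dominate in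
    \<open>q - p\<close>, and the last entry brings \<open>q\<close> within \<open>min e e'\<close>
    of \<open>p\<close>.\<close>
  define l where "l = Max {L, \<bar>\<mu>\<bar> + 1, 2 / (pi * norm N * min e e') + 1}"
  have lam: "l \<ge> L" "l > \<bar>\<mu>\<bar>" "l > 2 / (pi * norm N * min e e')" "l > 0"
    using L(1) by (auto simp: l_def less_max_iff_disj le_max_iff_disj)
  define m where "m = l\<^sup>2 + \<mu>\<^sup>2"
  have m: "m > 0" "m \<ge> l\<^sup>2" using lam(4) by (auto simp: m_def add_pos_nonneg)
  \<comment> \<open>Normalised so that \<open>pi * D = k\<close>, where \<open>D\<close> is the
    squared length of \<open>z\<close>; the rotated inversion of \<open>z\<close> is then exactly
    \<open>l T + \<mu> N\<close>.\<close>
  define k where "k = 1 / (pi * m * n)"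
  have k: "k > 0" "pi * k * m * n = 1" using m n by (auto simp: k_def)
  define z where "z = - k *\<^sub>R (l *\<^sub>R N - \<mu> *\<^sub>R T)"
  have z_nth: "z $ 1 = - k * (l * N $ 1 + \<mu> * N $ 2)" "z $ 2 = - k * (l * N $ 2 - \<mu> * N $ 1)"
    by (simp_all add: z_def T_nth algebra_simps)
  define D where "D = k\<^sup>2 * m * n"
  have D: "z $ 1 * z $ 1 + z $ 2 * z $ 2 = D"
    unfolding z_nth D_def m_def n(2) by (simp add: algebra_simps power2_eq_square)
  have D0: "D > 0" using k m n by (simp add: D_def)
  have z0: "z \<noteq> 0" using D D0 by auto
  have piD: "pi * D = k" using k(2) by (simp add: D_def power2_eq_square)
  have vz: "vortex z $ 1 = l * T $ 1 + \<mu> * N $ 1" "vortex z $ 2 = l * T $ 2 + \<mu> * N $ 2"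
    unfolding vortex_nth D piD using k(1) by (simp_all add: z_nth T_nth field_simps)
  define q where "q = p - z"
  have pq: "p - q = z" "p + t *\<^sub>R T - q = z + t *\<^sub>R T" for t by (simp_all add: q_def)
  have speed: "normal_speed \<rho> Q (p, q) = 0"
  proof -
    have "normal_speed \<rho> Q (p, q) = N $ 1 * (l * T $ 1 + \<mu> * N $ 1 + g $ 1) + N $ 2 * (l * T $ 2 + \<mu> * N $ 2 + g $ 2)"
      unfolding normal_speed_eq using \<rho>(2) by (simp add: pq vz g_nth grad_nth flip: \<rho>(2))
    also have "\<dots> = \<mu> * n + N \<bullet> g" by (simp add: T_nth n(2) inner_2 algebra_simps)
    also have "\<dots> = 0" using n(1) by (simp add: \<mu>_def)
    finally show ?thesis .
  qed
  have zT: "z \<bullet> T = k * \<mu> * n"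
    by (simp add: inner_2 z_nth T_nth n(2) algebra_simps)
  \<comment> \<open>The normal component of the change of the vortex velocity along
    \<open>T\<close>: it supplies the leading term of \<open>\<delta>\<close>.\<close>
  have key: "N $ 1 * ((T $ 2 * D - 2 * z $ 2 * (z \<bullet> T)) / (pi * D\<^sup>2)) + N $ 2 * ((2 * z $ 1 * (z \<bullet> T) - T $ 1 * D) / (pi * D\<^sup>2))
      = pi * n\<^sup>2 * (l\<^sup>2 - \<mu>\<^sup>2)"
  proof -
    have "N $ 1 * (T $ 2 * D - 2 * z $ 2 * (z \<bullet> T)) + N $ 2 * (2 * z $ 1 * (z \<bullet> T) - T $ 1 * D)
        = n * D - 2 * (k * \<mu> * n)\<^sup>2"
      unfolding zT by (simp add: z_nth T_nth n(2) algebra_simps power2_eq_square)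
    also have "\<dots> = k\<^sup>2 * n\<^sup>2 * (l\<^sup>2 - \<mu>\<^sup>2)" by (simp add: D_def m_def algebra_simps power2_eq_square)
    finally have num: "N $ 1 * (T $ 2 * D - 2 * z $ 2 * (z \<bullet> T)) + N $ 2 * (2 * z $ 1 * (z \<bullet> T) - T $ 1 * D)
      = k\<^sup>2 * n\<^sup>2 * (l\<^sup>2 - \<mu>\<^sup>2)" .
    have "pi * (pi * D\<^sup>2) = (pi * D)\<^sup>2" by (simp add: power2_eq_square)
    then have "k\<^sup>2 = pi * (pi * D\<^sup>2)" unfolding piD by simp
    then have "k\<^sup>2 / (pi * D\<^sup>2) = pi" using D0 by simp
    moreover have "k\<^sup>2 * n\<^sup>2 * w / (pi * D\<^sup>2) = k\<^sup>2 / (pi * D\<^sup>2) * n\<^sup>2 * w" for w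
      by (simp only: times_divide_eq_left)
    ultimately show ?thesis
      unfolding times_divide_eq_right add_divide_distrib[symmetric] num by (simp only:)
  qed
  have dV: "((\<lambda>t. vortex (p + t *\<^sub>R T - q) $ 1) has_real_derivative (T $ 2 * D - 2 * z $ 2 * (z \<bullet> T)) / (pi * D\<^sup>2)) (at 0)"
    "((\<lambda>t. vortex (p + t *\<^sub>R T - q) $ 2) has_real_derivative (2 * z $ 1 * (z \<bullet> T) - T $ 1 * D) / (pi * D\<^sup>2)) (at 0)"
    unfolding pq by (rule vortex_directional_derivative[OF D z0])+
  have dH: "((\<lambda>t. partial i \<rho> (p + t *\<^sub>R T)) has_real_derivative H i) (at 0)" for i
    unfolding H_def by (rule smooth_on_directional_derivative[OF V(1) smooth_on_partial[OF V(2)] V(3)])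
  have dP: "((\<lambda>t. partial i Q (p + t *\<^sub>R T)) has_real_derivative P i) (at 0)" for i
    unfolding P_def by (rule smooth_on_directional_derivative[OF open_UNIV smooth_on_partial[OF Q]]) simp
  \<comment> \<open>\<open>b\<close> is the Hessian of \<open>\<rho>\<close> on \<open>T\<close>,
    paired with the large velocity \<open>l T\<close>; \<open>c\<close> collects what does not
    depend on \<open>l\<close>, including the \<open>\<mu>\<close> part of
    \<open>key\<close>.\<close>
  define \<delta> where "\<delta> = pi * n\<^sup>2 * l\<^sup>2 + b * l + c"
  have deriv: "((\<lambda>t. normal_speed \<rho> Q (p + t *\<^sub>R T, q)) has_real_derivative \<delta>) (at 0)"
    unfolding normal_speed_eq fst_conv snd_conv
  proof (rule DERIV_cong[OF DERIV_add[OF DERIV_mult[OF dH DERIV_add[OF dV(1) dP]] DERIV_mult[OF dH DERIV_diff[OF dV(2) dP]]]])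
    show "H 1 * (vortex (p + 0 *\<^sub>R T - q) $ 1 + partial 2 Q (p + 0 *\<^sub>R T)) +
        ((T $ 2 * D - 2 * z $ 2 * (z \<bullet> T)) / (pi * D\<^sup>2) + P 2) * partial 1 \<rho> (p + 0 *\<^sub>R T) +
        (H 2 * (vortex (p + 0 *\<^sub>R T - q) $ 2 - partial 1 Q (p + 0 *\<^sub>R T)) +
         ((2 * z $ 1 * (z \<bullet> T) - T $ 1 * D) / (pi * D\<^sup>2) - P 1) * partial 2 \<rho> (p + 0 *\<^sub>R T)) = \<delta>"
    proof -
      have N: "partial 1 \<rho> p = N $ 1" "partial 2 \<rho> p = N $ 2" using \<rho>(2) grad_nth by metis+
      have p0: "p + 0 *\<^sub>R T = p" by simp
      have dd: "\<delta> = H 1 * (vortex z $ 1 + g $ 1) + H 2 * (vortex z $ 2 + g $ 2) + N $ 1 * P 2 - N $ 2 * P 1 + pi * n\<^sup>2 * (l\<^sup>2 - \<mu>\<^sup>2)"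
        unfolding vz by (simp add: \<delta>_def b_def c_def algebra_simps)
      have aux: "h1 * (v1 + q2) + (a1 + p2) * n1 + (h2 * (v2 - q1) + (a2 - p1) * n2) = d"
        if "d = h1 * (v1 + q2) + h2 * (v2 + - q1) + n1 * p2 - n2 * p1 + (n1 * a1 + n2 * a2)"
        for h1 h2 v1 v2 q1 q2 a1 a2 p1 p2 n1 n2 d :: real
        using that by (simp add: algebra_simps)
      show ?thesis unfolding p0 pq N by (rule aux[OF dd[unfolded key[symmetric] g_nth]])
    qed
  qed
  have \<delta>: "\<delta> > 0" unfolding \<delta>_def by (rule L(2)[OF lam(1)])
  have qp: "q - p = k *\<^sub>R (l *\<^sub>R N - \<mu> *\<^sub>R T)" by (simp add: q_def z_def)
  have nT: "norm T = norm N"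
    by (simp add: norm_eq_sqrt_inner inner_2 T_nth)
  have len: "norm (q - p) \<le> 2 * k * l * norm N"
  proof -
    have "norm (l *\<^sub>R N - \<mu> *\<^sub>R T) \<le> l * norm N + \<bar>\<mu>\<bar> * norm N"
      using norm_triangle_ineq4[of "l *\<^sub>R N" "\<mu> *\<^sub>R T"] lam(4) nT by simp
    also have "\<dots> \<le> l * norm N + l * norm N" using lam(2) by (intro add_mono mult_right_mono) auto
    finally show ?thesis unfolding qp using k(1) by (simp add: mult_left_mono)
  qed
  have "norm (q - p) < min e e'"
  proof -
    have "2 * k * l * norm N = 2 * l / (pi * m * norm N)"
      using \<rho>(3) by (simp add: k_def n_def power2_eq_square)
    also have "\<dots> \<le> 2 * l / (pi * l\<^sup>2 * norm N)"
      using m lam(4) \<rho>(3) by (intro divide_left_mono mult_right_mono mult_left_mono mult_pos_pos) auto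
    also have "\<dots> = 2 / (pi * norm N) / l" using lam(4) by (simp add: power2_eq_square)
    also have "\<dots> < min e e'"
    proof -
      have "2 / (pi * norm N) < l * min e e'"
        using lam(3) e(1) e'(1) \<rho>(3) by (simp add: divide_less_eq mult_ac del: min_less_iff_conj)
      then show ?thesis using lam(4) by (metis pos_divide_less_eq mult.commute)
    qed
    finally show ?thesis using len by linarith
  qed
  then have qG: "q \<in> G" "q \<in> V" and qe': "norm (q - p) < e'"
    using e(2) by (auto simp: subset_iff dist_norm norm_minus_commute)
  have a1: "(q - p) \<bullet> N = k * l * n"
    unfolding qp by (simp add: inner_2 T_nth n(2) algebra_simps)
  have a2: "norm N / 4 * norm (q - p) \<le> k * l * n / 2"
    using mult_left_mono[OF len, of "norm N / 4"] by (simp add: n_def power2_eq_square mult_ac)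
  have a3: "k * l * n > 0" using k lam n by simp
  have "\<bar>\<rho> q - k * l * n\<bar> \<le> k * l * n / 2" using order_trans[OF e'(2)[OF qe'] a2] unfolding a1 \<rho>(1) by simp
  then have \<rho>q: "\<rho> q > 0" using a3 by linarith
  have qp0: "q \<noteq> p" using z0 by (simp add: q_def)
  show thesis by (rule that[OF qG qp0 \<rho>q speed \<delta> deriv])
qed

section \<open>Short chords\<close>

text \<open>The part of \<open>V\<close> with \<open>\<rho> > 0\<close> is open and misses the
  domain, hence also its closure.\<close>

lemma local_defining_function_outside:
  assumes "local_defining_function \<Omega> p V \<rho>" "x \<in> V" "\<rho> x > 0"
  shows "x \<notin> closure \<Omega>"
proof -
  have V: "open V" "smooth_on V \<rho>" "\<Omega> \<inter> V = {x\<in>V. \<rho> x < 0}"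
    using assms(1) by (auto simp: local_defining_function_def)
  have "continuous_on V \<rho>" by (rule CK_imp_continuous_on[OF smooth_on_imp_CK[OF V(1,2), of 0]])
  then have "open (V \<inter> \<rho> -` {0<..})" using continuous_open_preimage[OF _ V(1), of \<rho> "{0<..}"] by simp
  moreover have "(V \<inter> \<rho> -` {0<..}) \<inter> \<Omega> = {}"
  proof -
    have "\<rho> y < 0" if "y \<in> \<Omega>" "y \<in> V" for y using V(3) that by blast
    then show ?thesis by (force dest: less_asym)
  qed
  ultimately have "(V \<inter> \<rho> -` {0<..}) \<inter> closure \<Omega> = {}" using open_Int_closure_eq_empty by blast
  then show ?thesis using assms(2,3) by auto
qed

text \<open>As the gradient does not vanish, moving along \<open>- grad \<rho> x\<close> makes
  \<open>\<rho>\<close> negative at once, so points of the domain accumulate at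
  \<open>x\<close>.\<close>

lemma local_defining_function_boundary:
  assumes "local_defining_function \<Omega> p V \<rho>" "open \<Omega>" "x \<in> V" "\<rho> x = 0"
  shows "x \<in> frontier \<Omega>"
proof -
  have V: "open V" "smooth_on V \<rho>" "\<Omega> \<inter> V = {x\<in>V. \<rho> x < 0}" "grad \<rho> x \<noteq> 0"
    using assms by (auto simp: local_defining_function_def)
  define v where "v = - grad \<rho> x"
  have "((\<lambda>t. \<rho> (x + t *\<^sub>R v)) has_real_derivative v \<bullet> grad \<rho> x) (at 0)"
    by (rule smooth_on_directional_derivative[OF V(1,2) assms(3)])
  moreover have "v \<bullet> grad \<rho> x < 0" using V(4) by (simp add: v_def)
  ultimately obtain d where d: "d > 0" "\<And>t. 0 < t \<Longrightarrow> t < d \<Longrightarrow> \<rho> (x + t *\<^sub>R v) < 0"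
    using DERIV_neg_dec_right[of "\<lambda>t. \<rho> (x + t *\<^sub>R v)" _ 0] assms(4) by auto
  obtain e where e: "e > 0" "ball x e \<subseteq> V" using V(1) assms(3) openE by blast
  have "x \<in> closure \<Omega>" unfolding closure_approachable
  proof (intro allI impI)
    fix \<epsilon> :: real assume "\<epsilon> > 0"
    define t where "t = min (d / 2) (min \<epsilon> e / (2 * norm v))"
    have v0: "norm v > 0" using V(4) by (simp add: v_def)
    have t: "0 < t" "t < d" using d e(1) \<open>\<epsilon> > 0\<close> v0 by (auto simp: t_def)
    have "t * norm v \<le> min \<epsilon> e / (2 * norm v) * norm v"
      using v0 by (intro mult_right_mono) (auto simp: t_def)
    also have "\<dots> = min \<epsilon> e / 2" using v0 by simp
    also have "\<dots> < min \<epsilon> e" using e(1) \<open>\<epsilon> > 0\<close> by (simp add: min_def)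
    finally have l: "t * norm v < min \<epsilon> e" .
    then have "x + t *\<^sub>R v \<in> V" using t by (intro subsetD[OF e(2)]) (simp add: dist_norm)
    then have "x + t *\<^sub>R v \<in> \<Omega>" using V(3) d(2)[OF t] by auto
    then show "\<exists>y\<in>\<Omega>. dist y x < \<epsilon>" using l t by (intro bexI[of _ "x + t *\<^sub>R v"]) (auto simp: dist_norm)
  qed
  moreover have "x \<notin> \<Omega>"
  proof
    assume "x \<in> \<Omega>"
    then have "\<rho> x < 0" using V(3) assms(3) by blast
    then show False using assms(4) by simp
  qed
  ultimately show ?thesis using assms(2) by (simp add: frontier_def interior_open)
qed

lemma local_defining_function_zero:
  assumes "local_defining_function \<Omega> p V \<rho>" "open \<Omega>" "p \<in> frontier \<Omega>"
  shows "\<rho> p = 0"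
proof -
  have V: "p \<in> V" "\<Omega> \<inter> V = {x\<in>V. \<rho> x < 0}" using assms by (auto simp: local_defining_function_def)
  have "p \<notin> \<Omega>" "p \<in> closure \<Omega>" using assms(2,3) by (auto simp: frontier_def interior_open)
  then show ?thesis using local_defining_function_outside[OF assms(1) V(1)] V by force
qed

section \<open>Solutions and exit times\<close>

text \<open>The source of all solutions below: an infimum over the empty set is infinite, so a
  finite exit time yields a time \<open>s\<close> of the lifetime with the first vortex outside. As
  \<open>s\<close> is at least the exit time, the solution covers the whole passage.\<close>

lemma exit_time_finite_solution:
  assumes "smooth_on UNIV Q" "exit_time Q \<Omega> x y < \<infinity>"
  obtains J ap am s where "dipole_solution Q x y J ap am" "s \<in> J" "0 \<le> s" "ap s \<notin> closure \<Omega>"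
    "exit_time Q \<Omega> x y \<le> ereal s"
proof -
  have "{s. 0 \<le> s \<and> s \<in> life Q x y \<and> a_plus Q x y s \<notin> closure \<Omega>} \<noteq> {}"
  proof
    assume "{s. 0 \<le> s \<and> s \<in> life Q x y \<and> a_plus Q x y s \<notin> closure \<Omega>} = {}"
    then have "exit_time Q \<Omega> x y = \<infinity>"
      unfolding exit_time_def by (simp only: image_empty Inf_empty top_ereal_def)
    then show False using assms(2) by simp
  qed
  then obtain s where s: "0 \<le> s" "s \<in> life Q x y" "a_plus Q x y s \<notin> closure \<Omega>" by blast
  then obtain J ap am where J: "dipole_solution Q x y J ap am" "s \<in> J" unfolding life_iff by blast
  moreover have "exit_time Q \<Omega> x y \<le> ereal s"
    unfolding exit_time_def using s by (intro Inf_lower) auto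
  ultimately show thesis using that s dipole_solution_a(1)[OF assms(1) J] by metis
qed

lemma exit_time_le:
  assumes "smooth_on UNIV Q" "dipole_solution Q x y J ap am" "s \<in> J" "0 \<le> s" "ap s \<notin> closure \<Omega>"
  shows "exit_time Q \<Omega> x y \<le> ereal s"
  unfolding exit_time_def using assms dipole_solution_a(1,3)[OF assms(1-3)]
  by (intro Inf_lower) auto

lemma exit_time_ge:
  assumes Q: "smooth_on UNIV Q" and sol: "dipole_solution Q x y J ap am"
    and J: "{0..<t} \<subseteq> J" and inside: "\<And>s. 0 \<le> s \<Longrightarrow> s < t \<Longrightarrow> ap s \<in> closure \<Omega>"
  shows "ereal t \<le> exit_time Q \<Omega> x y"
  unfolding exit_time_def
proof (rule Inf_greatest, safe)
  fix s assume s: "0 \<le> s" "a_plus Q x y s \<notin> closure \<Omega>"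
  show "ereal t \<le> ereal s"
  proof (rule ccontr)
    assume "\<not> ereal t \<le> ereal s"
    then have "s < t" by simp
    then have "s \<in> J" using J s(1) by auto
    then show False using dipole_solution_a(1)[OF Q sol] inside[OF s(1) \<open>s < t\<close>] s(2) by simp
  qed
qed

lemma dipole_solution_curve:
  assumes "dipole_solution Q x y J ap am"
  shows "s \<in> J \<Longrightarrow> ((\<lambda>s. (ap s, am s)) has_vector_derivative dipole_field Q (ap s, am s)) (at s)"
    and "ap 0 = x" "am 0 = y" "0 \<in> J"
    and "t \<in> J \<Longrightarrow> 0 \<le> t \<Longrightarrow> {0..t} \<subseteq> J"
  using assms unfolding dipole_solution_iff by (auto simp: is_interval_1)

lemma dipole_solution_defining_function:
  assumes \<rho>: "open V" "smooth_on V \<rho>" and sol: "dipole_solution Q x y J ap am" and s: "s \<in> J" "ap s \<in> V"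
  shows "((\<lambda>s. \<rho> (ap s)) has_real_derivative normal_speed \<rho> Q (ap s, am s)) (at s)"
proof -
  have "((\<lambda>s. fst (ap s, am s)) has_vector_derivative fst (dipole_field Q (ap s, am s))) (at s)"
    by (rule bounded_linear.has_vector_derivative[OF bounded_linear_fst dipole_solution_curve(1)[OF sol s(1)]])
  then have "(ap has_derivative (\<lambda>h. h *\<^sub>R fst (dipole_field Q (ap s, am s)))) (at s)"
    by (simp add: has_vector_derivative_def)
  from has_derivative_compose[OF this smooth_on_has_derivative[OF \<rho> s(2)]]
  have "((\<lambda>s. \<rho> (ap s)) has_derivative (\<lambda>h. (h *\<^sub>R fst (dipole_field Q (ap s, am s))) \<bullet> grad \<rho> (ap s))) (at s)" .
  moreover have "(\<lambda>h. (h *\<^sub>R fst (dipole_field Q (ap s, am s))) \<bullet> grad \<rho> (ap s)) = (*) (normal_speed \<rho> Q (ap s, am s))"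
    by (auto simp: normal_speed_def fun_eq_iff inner_commute)
  ultimately show ?thesis by (simp add: has_field_derivative_def)
qed

lemma continuous_on_dipole_field: "smooth_on UNIV Q \<Longrightarrow> continuous_on off_diagonal (dipole_field Q)"
  unfolding continuous_on_componentwise[of _ "dipole_field Q"]
  using CK_imp_continuous_on CK_dipole_field by blast

text \<open>The chords starting at \<open>x\<close> with normal speed \<open>- \<epsilon>\<close> leave the domain before time \<open>3 \<epsilon> / \<kappa>\<close>. As
  they shrink, the displacement of the second vortex divided by the exit time, which is part of the
  data, tends to its initial velocity.\<close>

lemma short_chords_determine_gradient:
  assumes Q: "smooth_on UNIV Q" and Q': "smooth_on UNIV Q'"
    and \<Omega>: "open \<Omega>" "local_defining_function \<Omega> p V \<rho>"
    and X0: "x0 \<in> V" "x0 \<noteq> b" "b \<notin> closure \<Omega>"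
    and k: "continuous_on ({X. fst X \<in> V} \<inter> off_diagonal) k"
      "\<And>Z s. (Z has_vector_derivative dipole_field Q (Z s)) (at s) \<Longrightarrow> Z s \<in> {X. fst X \<in> V} \<inter> off_diagonal \<Longrightarrow>
        ((\<lambda>s. normal_speed \<rho> Q (Z s)) has_real_derivative k (Z s)) (at s)"
    and k0: "k (x0, b) > 0"
    and near: "\<epsilon>0 > 0" "C > 0" "\<And>\<epsilon>. 0 < \<epsilon> \<Longrightarrow> \<epsilon> < \<epsilon>0 \<Longrightarrow>
      \<exists>x. \<rho> x = 0 \<and> normal_speed \<rho> Q (x, b) = - \<epsilon> \<and> norm (x - x0) \<le> C * \<epsilon>"
    and data: "\<And>x. x \<in> frontier \<Omega> \<Longrightarrow> x \<noteq> b \<Longrightarrow> exit_time Q \<Omega> x b < \<infinity>"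
      "\<And>x. x \<in> frontier \<Omega> \<Longrightarrow> x \<noteq> b \<Longrightarrow> measurement Q' \<Omega> x b = measurement Q \<Omega> x b"
  shows "perp_grad Q' b = perp_grad Q b"
proof -
  have V: "open V" "smooth_on V \<rho>" "\<Omega> \<inter> V = {x\<in>V. \<rho> x < 0}"
    using \<Omega>(2) by (auto simp: local_defining_function_def)
  define S where "S = {X. fst X \<in> V} \<inter> off_diagonal"
  have "open {X :: (real^2) \<times> (real^2). fst X \<in> V}"
    using open_vimage_fst[OF V(1)] by (simp add: vimage_def)
  then have S: "open S" "(x0, b) \<in> S" using X0 open_off_diagonal by (auto simp: S_def off_diagonal_def)
  define F F' where "F = dipole_field Q" and "F' = dipole_field Q'"
  have F: "isCont F (x0, b)" "isCont F' (x0, b)"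
    using continuous_on_dipole_field[OF Q] continuous_on_dipole_field[OF Q'] S(2) open_off_diagonal
    unfolding F_def F'_def by (auto simp: S_def continuous_on_eq_continuous_at)
  have kc: "isCont k (x0, b)" using k(1) S by (auto simp: S_def[symmetric] continuous_on_eq_continuous_at)
  \<comment> \<open>Half of the value at \<open>(x0, b)\<close>, so that \<open>\<kappa> < k\<close>
    persists on a ball.\<close>
  define \<kappa> where "\<kappa> = k (x0, b) / 2"
  have \<kappa>: "\<kappa> > 0" using k0 by (simp add: \<kappa>_def)
  \<comment> \<open>In place of a limit, one sufficiently short chord is used for each
    \<open>\<eta>\<close>.\<close>
  have bound: "norm (snd (F' (x0, b)) - snd (F (x0, b))) \<le> 2 * \<eta>" if "\<eta> > 0" for \<eta>
  proof -
    have "\<forall>\<^sub>F X in nhds (x0, b). X \<in> S" using S by (rule eventually_nhds_in_open)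
    moreover have "\<forall>\<^sub>F X in nhds (x0, b). dist (F X) (F (x0, b)) < \<eta>" "\<forall>\<^sub>F X in nhds (x0, b). dist (F' X) (F' (x0, b)) < \<eta>"
      using F that unfolding isCont_def tendsto_at_iff_tendsto_nhds by (blast intro: tendstoD)+
    moreover have "\<forall>\<^sub>F X in nhds (x0, b). \<kappa> < k X"
      using kc k0 unfolding isCont_def tendsto_at_iff_tendsto_nhds by (intro order_tendstoD) (auto simp: \<kappa>_def)
    moreover have "\<forall>\<^sub>F X in nhds (x0, b). X \<in> snd -` (- closure \<Omega>)"
      using X0(3) by (intro eventually_nhds_in_open open_vimage_snd) auto
    ultimately have "\<forall>\<^sub>F X in nhds (x0, b). X \<in> S \<and> dist (F X) (F (x0, b)) < \<eta> \<and> dist (F' X) (F' (x0, b)) < \<eta> \<and>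
        \<kappa> < k X \<and> snd X \<notin> closure \<Omega>"
      by eventually_elim auto
    then obtain r where r: "r > 0" and rr: "\<And>X. X \<in> ball (x0, b) r \<Longrightarrow> X \<in> S \<and> dist (F X) (F (x0, b)) < \<eta> \<and>
        dist (F' X) (F' (x0, b)) < \<eta> \<and> \<kappa> < k X \<and> snd X \<notin> closure \<Omega>"
      unfolding eventually_nhds_metric mem_ball by (metis dist_commute)
    define M where "M = max (norm (F (x0, b))) (norm (F' (x0, b))) + \<eta>"
    have M: "M > 0" using that by (simp add: M_def add_nonneg_pos le_max_iff_disj)
    have FM: "norm (F X) \<le> M" "norm (F' X) \<le> M" if "X \<in> ball (x0, b) r" for X
      using rr[OF that] norm_triangle_sub[of "F X" "F (x0, b)"] norm_triangle_sub[of "F' X" "F' (x0, b)"]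
      by (auto simp: M_def dist_norm)
    \<comment> \<open>\<open>C * \<epsilon>\<close> bounds the distance of the start from
      \<open>x0\<close>, and \<open>3 / \<kappa> * M * \<epsilon>\<close> the travel up to time
      \<open>T\<close>; with \<open>A * \<epsilon> < r\<close> the trajectories stay in the
      ball.\<close>
    define A where "A = C + 3 / \<kappa> * M"
    have A: "A > 0" using near(2) \<kappa> M by (simp add: A_def add_pos_pos)
    define \<epsilon> where "\<epsilon> = min (\<epsilon>0 / 2) (r / (2 * A))"
    have \<epsilon>: "0 < \<epsilon>" "\<epsilon> < \<epsilon>0" using near(1) r A by (auto simp: \<epsilon>_def)
    have "A * \<epsilon> \<le> A * (r / (2 * A))" using A by (intro mult_left_mono) (auto simp: \<epsilon>_def)
    also have "\<dots> = r / 2" using A by simp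
    also have "\<dots> < r" using r by simp
    finally have A\<epsilon>: "A * \<epsilon> < r" .
    \<comment> \<open>Along the trajectory
      \<open>\<rho> \<ge> - \<epsilon> * s + \<kappa> * s\<^sup>2 / 2\<close>, a parabola that
      vanishes at \<open>2 * \<epsilon> / \<kappa>\<close> and has the value
      \<open>\<epsilon> * T / 2 > 0\<close> at \<open>T\<close>.\<close>
    define T where "T = 3 * \<epsilon> / \<kappa>"
    have T: "T > 0" using \<epsilon>(1) \<kappa> by (simp add: T_def)
    obtain x where x: "\<rho> x = 0" "normal_speed \<rho> Q (x, b) = - \<epsilon>" "norm (x - x0) \<le> C * \<epsilon>"
      using near(3)[OF \<epsilon>] by blast
    have start: "norm ((x, b) - (x0, b)) + T * M < r"
    proof -
      have "norm ((x, b) - (x0, b)) = norm (x - x0)" by (simp add: norm_Pair)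
      then have "norm ((x, b) - (x0, b)) + T * M \<le> A * \<epsilon>" using x(3) by (simp add: A_def T_def algebra_simps)
      then show ?thesis using A\<epsilon> by simp
    qed
    have "norm ((x, b) - (x0, b)) < r" using start mult_pos_pos[OF T M] by linarith
    then have xb: "(x, b) \<in> ball (x0, b) r" by (simp only: mem_ball dist_norm norm_minus_commute)
    have xV: "x \<in> V" "x \<noteq> b" using rr[OF xb] by (auto simp: S_def off_diagonal_def)
    have xf: "x \<in> frontier \<Omega>" by (rule local_defining_function_boundary[OF \<Omega>(2,1) xV(1) x(1)])
    obtain J ap am s1 where sol: "dipole_solution Q x b J ap am" and s1: "s1 \<in> J" "0 \<le> s1" "ap s1 \<notin> closure \<Omega>"
      "exit_time Q \<Omega> x b \<le> ereal s1"
      using exit_time_finite_solution[OF Q data(1)[OF xf xV(2)]] by blast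
    note curve = dipole_solution_curve[OF sol]
    have stays: "(ap s, am s) \<in> ball (x0, b) r" if s: "s \<in> J" "0 \<le> s" "s \<le> T" for s
    proof (rule curve_stays_in_ball[where G = "\<lambda>s. F (ap s, am s)" and M = M and t = s])
      show "((\<lambda>s. (ap s, am s)) has_vector_derivative F (ap s', am s')) (at s')" if "s' \<in> {0..s}" for s'
        using curve(1)[of s'] curve(5)[OF s(1,2)] that unfolding F_def by blast
      have "s * M \<le> T * M" using s(3) M by simp
      then show "norm ((ap 0, am 0) - (x0, b)) + s * M < r" using start curve(2,3) by simp
    qed (use FM M s in auto)
    have R: "((\<lambda>s. \<rho> (ap s)) has_real_derivative normal_speed \<rho> Q (ap s, am s)) (at s)"
      and R': "((\<lambda>s. normal_speed \<rho> Q (ap s, am s)) has_real_derivative k (ap s, am s)) (at s)"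
      if "s \<in> J" "0 \<le> s" "s \<le> T" for s
    proof -
      have st: "(ap s, am s) \<in> S" using rr[OF stays[OF that]] by blast
      show "((\<lambda>s. \<rho> (ap s)) has_real_derivative normal_speed \<rho> Q (ap s, am s)) (at s)"
        by (rule dipole_solution_defining_function[OF V(1,2) sol that(1)]) (use st in \<open>auto simp: S_def\<close>)
      show "((\<lambda>s. normal_speed \<rho> Q (ap s, am s)) has_real_derivative k (ap s, am s)) (at s)"
        by (rule k(2)[OF curve(1)[OF that(1)]]) (use st in \<open>simp add: S_def\<close>)
    qed
    have le_T: "exit_time Q \<Omega> x b \<le> ereal T"
    proof (cases "s1 \<le> T")
      case True
      then show ?thesis using s1(4) by (meson ereal_less_eq(3) order_trans)
    next
      case False
      then have TJ: "T \<in> J" "{0..T} \<subseteq> J" using curve(5)[OF s1(1,2)] T by auto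
      have g: "- \<epsilon> + \<kappa> * s \<le> normal_speed \<rho> Q (ap s, am s)" if s: "0 \<le> s" "s \<le> T" for s
      proof -
        have "normal_speed \<rho> Q (ap 0, am 0) - \<kappa> * 0 \<le> normal_speed \<rho> Q (ap s, am s) - \<kappa> * s"
        proof (rule DERIV_nonneg_imp_nondecreasing[OF s(1)])
          fix u assume u: "0 \<le> u" "u \<le> s"
          then have uJ: "u \<in> J" "0 \<le> u" "u \<le> T" using TJ(2) s by auto
          have "((\<lambda>u. normal_speed \<rho> Q (ap u, am u) - \<kappa> * u) has_real_derivative k (ap u, am u) - \<kappa>) (at u)"
            using R'[OF uJ] by (auto intro!: derivative_eq_intros)
          moreover have "0 \<le> k (ap u, am u) - \<kappa>" using rr[OF stays[OF uJ]] by simp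
          ultimately show "\<exists>y. ((\<lambda>u. normal_speed \<rho> Q (ap u, am u) - \<kappa> * u) has_real_derivative y) (at u) \<and> 0 \<le> y"
            by blast
        qed
        then show ?thesis using x(2) curve(2,3) by simp
      qed
      have "\<rho> (ap 0) + \<epsilon> * 0 - \<kappa> * 0\<^sup>2 / 2 \<le> \<rho> (ap T) + \<epsilon> * T - \<kappa> * T\<^sup>2 / 2"
      proof (rule DERIV_nonneg_imp_nondecreasing[where f = "\<lambda>u. \<rho> (ap u) + \<epsilon> * u - \<kappa> * u\<^sup>2 / 2"])
        fix u assume u: "0 \<le> u" "u \<le> T"
        then have uJ: "u \<in> J" "0 \<le> u" "u \<le> T" using TJ(2) by auto
        have "((\<lambda>u. \<rho> (ap u) + \<epsilon> * u - \<kappa> * u\<^sup>2 / 2) has_real_derivative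
            normal_speed \<rho> Q (ap u, am u) + \<epsilon> - \<kappa> * u) (at u)"
          using R[OF uJ] by (auto intro!: derivative_eq_intros)
        moreover have "0 \<le> normal_speed \<rho> Q (ap u, am u) + \<epsilon> - \<kappa> * u" using g[OF u] by simp
        ultimately show "\<exists>y. ((\<lambda>u. \<rho> (ap u) + \<epsilon> * u - \<kappa> * u\<^sup>2 / 2) has_real_derivative y) (at u) \<and> 0 \<le> y"
          by blast
      qed (use T in simp)
      moreover have "\<kappa> * T\<^sup>2 / 2 - \<epsilon> * T = \<epsilon> * T / 2"
        using \<kappa> by (simp add: T_def power2_eq_square field_simps)
      moreover have "\<epsilon> * T / 2 > 0" using \<epsilon>(1) T by simp
      ultimately have "\<rho> (ap T) > 0" unfolding curve(2) x(1) by (simp add: mult.commute)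
      moreover have "ap T \<in> V" using rr[OF stays[OF TJ(1)]] T by (simp add: S_def)
      ultimately have "ap T \<notin> closure \<Omega>" by (intro local_defining_function_outside[OF \<Omega>(2)])
      then show ?thesis using T by (intro exit_time_le[OF Q sol TJ(1)]) auto
    qed
    \<comment> \<open>The negative initial normal speed sends the first vortex into the domain, so
      the exit is not immediate; the final division by \<open>\<tau>\<close> depends on
      this.\<close>
    have pos: "exit_time Q \<Omega> x b > 0"
    proof -
      have "normal_speed \<rho> Q (ap 0, am 0) < 0" using x(2) \<epsilon>(1) curve(2,3) by simp
      then obtain d where d: "d > 0" "\<And>s. 0 < s \<Longrightarrow> s < d \<Longrightarrow> \<rho> (ap s) < 0"
        using DERIV_neg_dec_right[OF R[OF curve(4)]] T x(1) curve(2) by auto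
      have xc: "x \<in> closure \<Omega>" using xf by (simp add: frontier_def)
      then have "s1 \<noteq> 0" using s1(3) curve(2) by auto
      define t where "t = min (min d s1) T"
      have t: "t > 0" using d(1) \<open>s1 \<noteq> 0\<close> s1(2) T by (simp add: t_def)
      have tJ: "{0..<t} \<subseteq> J" using curve(5)[OF s1(1,2)] by (auto simp: t_def subset_iff)
      have "ereal t \<le> exit_time Q \<Omega> x b"
      proof (rule exit_time_ge[OF Q sol tJ])
        fix s assume s: "0 \<le> s" "s < t"
        show "ap s \<in> closure \<Omega>"
        proof (cases "s = 0")
          case True
          then show ?thesis using xc curve(2) by simp
        next
          case False
          then have "\<rho> (ap s) < 0" using d(2)[of s] s by (simp add: t_def)
          moreover have "ap s \<in> V" using rr[OF stays[of s]] s tJ by (auto simp: S_def t_def)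
          ultimately show ?thesis using V(3) closure_subset by blast
        qed
      qed
      then show ?thesis using t by (meson ereal_less(2) less_le_trans)
    qed
    obtain \<tau> where \<tau>: "exit_time Q \<Omega> x b = ereal \<tau>" "0 < \<tau>" "\<tau> \<le> T" "\<tau> \<le> s1"
      using pos le_T s1(4) by (cases "exit_time Q \<Omega> x b") auto
    have \<tau>J: "\<tau> \<in> J" using curve(5)[OF s1(1,2)] \<tau> by auto
    \<comment> \<open>The second vortex is still outside, so the measurement is a triple and
      contains its position.\<close>
    have "am \<tau> \<notin> \<Omega>" using rr[OF stays[OF \<tau>J]] \<tau> closure_subset by fastforce
    then have "measurement Q \<Omega> x b = Inl (ereal \<tau>, ap \<tau>, am \<tau>)"
      unfolding measurement_def using dipole_solution_a(1,2)[OF Q sol \<tau>J] by (simp add: \<tau>(1))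
    then have "measurement Q' \<Omega> x b = Inl (ereal \<tau>, ap \<tau>, am \<tau>)" using data(2)[OF xf xV(2)] by simp
    then have e': "exit_time Q' \<Omega> x b = ereal \<tau>" and am': "a_minus Q' x b \<tau> = am \<tau>"
      unfolding measurement_def Let_def by (auto split: if_splits)
    \<comment> \<open>Finiteness for \<open>Q'\<close> is read off the equal data and provides the
      second solution.\<close>
    have "exit_time Q' \<Omega> x b < \<infinity>" using e' by simp
    then obtain J' ap' am' s2 where sol': "dipole_solution Q' x b J' ap' am'" and s2: "s2 \<in> J'" "0 \<le> s2" "\<tau> \<le> s2"
      by (rule exit_time_finite_solution[OF Q']) (use e' in auto)
    note curve' = dipole_solution_curve[OF sol']
    have \<tau>J': "\<tau> \<in> J'" "{0..\<tau>} \<subseteq> J'" using curve'(5)[OF s2(1,2)] \<tau>(2) s2(3) by auto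
    have "am' \<tau> = am \<tau>" using dipole_solution_a(2)[OF Q' sol' \<tau>J'(1)] am' by simp
    have stays': "(ap' s, am' s) \<in> ball (x0, b) r" if s: "0 \<le> s" "s \<le> \<tau>" for s
    proof (rule curve_stays_in_ball[where G = "\<lambda>s. F' (ap' s, am' s)" and M = M and t = s])
      show "((\<lambda>s. (ap' s, am' s)) has_vector_derivative F' (ap' s', am' s')) (at s')" if "s' \<in> {0..s}" for s'
        using curve'(1)[of s'] subsetD[OF \<tau>J'(2), of s'] that s unfolding F'_def by auto
      have "s * M \<le> T * M" using s \<tau>(3) M by simp
      then show "norm ((ap' 0, am' 0) - (x0, b)) + s * M < r" using start curve'(2,3) by simp
    qed (use FM M s in auto)
    have snd_le: "norm (snd W) \<le> norm W" for W :: "(real^2) \<times> (real^2)"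
      by (metis norm_snd_le prod.collapse)
    have "norm ((ap \<tau>, am \<tau>) - (ap 0, am 0) - \<tau> *\<^sub>R F (x0, b)) \<le> \<eta> * \<tau>"
    proof (rule curve_displacement[where G = "\<lambda>s. F (ap s, am s)"])
      show "((\<lambda>s. (ap s, am s)) has_vector_derivative F (ap s, am s)) (at s)" if "s \<in> {0..\<tau>}" for s
        using curve(1)[of s] curve(5)[OF \<tau>J] that \<tau>(2) unfolding F_def by auto
      show "norm (F (ap s, am s) - F (x0, b)) \<le> \<eta>" if "0 < s" "s < \<tau>" for s
        using rr[OF stays[of s]] that \<tau> subsetD[OF curve(5)[OF \<tau>J], of s] by (auto simp: dist_norm)
    qed (use \<tau> in simp)
    then have 1: "norm (am \<tau> - b - \<tau> *\<^sub>R snd (F (x0, b))) \<le> \<eta> * \<tau>"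
      using order_trans[OF snd_le, of _ "\<eta> * \<tau>"] curve(3) by fastforce
    have "norm ((ap' \<tau>, am' \<tau>) - (ap' 0, am' 0) - \<tau> *\<^sub>R F' (x0, b)) \<le> \<eta> * \<tau>"
    proof (rule curve_displacement[where G = "\<lambda>s. F' (ap' s, am' s)"])
      show "((\<lambda>s. (ap' s, am' s)) has_vector_derivative F' (ap' s, am' s)) (at s)" if "s \<in> {0..\<tau>}" for s
        using curve'(1)[of s] \<tau>J'(2) that unfolding F'_def by auto
      show "norm (F' (ap' s, am' s) - F' (x0, b)) \<le> \<eta>" if "0 < s" "s < \<tau>" for s
        using rr[OF stays'[of s]] that by (auto simp: dist_norm)
    qed (use \<tau> in simp)
    then have 2: "norm (am \<tau> - b - \<tau> *\<^sub>R snd (F' (x0, b))) \<le> \<eta> * \<tau>"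
      using order_trans[OF snd_le, of _ "\<eta> * \<tau>"] curve'(3) \<open>am' \<tau> = am \<tau>\<close> by fastforce
    \<comment> \<open>Both second vortices start at \<open>b\<close> and are at
      \<open>am \<tau>\<close> at time \<open>\<tau>\<close>: the displacement cancels, and the
      initial velocities remain.\<close>
    have "\<tau> * norm (snd (F' (x0, b)) - snd (F (x0, b))) =
        norm ((am \<tau> - b - \<tau> *\<^sub>R snd (F (x0, b))) - (am \<tau> - b - \<tau> *\<^sub>R snd (F' (x0, b))))"
      using \<tau>(2) by (simp add: scaleR_diff_right[symmetric] abs_of_pos)
    also have "\<dots> \<le> \<eta> * \<tau> + \<eta> * \<tau>" using norm_triangle_ineq4 1 2 by (rule order_trans[OF _ add_mono])
    finally have "\<tau> * norm (snd (F' (x0, b)) - snd (F (x0, b))) \<le> \<tau> * (2 * \<eta>)" by (simp add: mult_ac)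
    then show ?thesis using \<tau>(2) by simp
  qed
  have "norm (snd (F' (x0, b)) - snd (F (x0, b))) \<le> 0"
    by (rule field_le_epsilon) (use bound[of "_ / 2"] in force)
  \<comment> \<open>The interaction terms agree at \<open>(x0, b)\<close>, which leaves the
    difference of the background terms.\<close>
  then show ?thesis by (simp add: F_def F'_def dipole_field_def)
qed

section \<open>Strict convexity forces short chords\<close>

text \<open>A one-sided Gronwall argument. If \<open>r\<close> were positive after time 0, let
  \<open>m > 0\<close> be the maximum of \<open>w\<close> on a short interval; then
  \<open>r \<le> m\<close> there, and the rise of \<open>w\<close> from its last nonpositive value
  up to \<open>m\<close> is at most \<open>m / 2\<close>.\<close>

lemma second_order_no_escape:
  fixes r w k :: "real \<Rightarrow> real"
  assumes \<delta>: "\<delta> > 0"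
    and r: "\<And>s. s \<in> {0..\<delta>} \<Longrightarrow> (r has_real_derivative w s) (at s)"
    and w: "\<And>s. s \<in> {0..\<delta>} \<Longrightarrow> (w has_real_derivative k s) (at s)"
    and k: "\<And>s. s \<in> {0..\<delta>} \<Longrightarrow> k s \<le> c * (\<bar>r s\<bar> + \<bar>w s\<bar>)" and c: "c \<ge> 0"
    and zero: "r 0 = 0" "w 0 = 0"
  shows "\<exists>s\<in>{0<..\<delta>}. r s \<le> 0"
proof (rule ccontr)
  assume "\<not> (\<exists>s\<in>{0<..\<delta>}. r s \<le> 0)"
  then have rpos: "\<And>s. 0 < s \<Longrightarrow> s \<le> \<delta> \<Longrightarrow> r s > 0" by force
  \<comment> \<open>\<open>d \<le> 1\<close> turns \<open>r s \<le> m * s\<close> into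
    \<open>r s \<le> m\<close>; \<open>d * c \<le> 1 / 4\<close> absorbs the bound
    \<open>c * (2 * m)\<close> on \<open>k\<close>.\<close>
  define d where "d = min \<delta> (min 1 (1 / (4 * (c + 1))))"
  have d: "d > 0" "d \<le> \<delta>" using \<delta> c by (auto simp: d_def)
  have d1: "d \<le> 1" unfolding d_def by (rule min.coboundedI2) (rule min.cobounded1)
  have dc: "d * c \<le> 1 / 4"
  proof -
    have "d * c \<le> 1 / (4 * (c + 1)) * c" using c by (intro mult_right_mono) (auto simp: d_def)
    also have "\<dots> \<le> 1 / 4" using c by (simp add: divide_simps)
    finally show ?thesis .
  qed
  have wcont: "continuous_on {0..\<delta>} w"
    using w by (intro continuous_at_imp_continuous_on ballI DERIV_isCont) blast
  obtain s3 where s3: "s3 \<in> {0..d}" "\<And>s. s \<in> {0..d} \<Longrightarrow> w s \<le> w s3"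
    using continuous_attains_sup[of "{0..d}" w] continuous_on_subset[OF wcont] d by force
  define m where "m = w s3"
  have rm: "r s \<le> m * s" if s: "0 \<le> s" "s \<le> d" for s
  proof -
    have "m * 0 - r 0 \<le> m * s - r s"
    proof (rule DERIV_nonneg_imp_nondecreasing[where f = "\<lambda>u. m * u - r u"])
      fix u assume u: "0 \<le> u" "u \<le> s"
      have "((\<lambda>u. m * u - r u) has_real_derivative m - w u) (at u)"
        using r[of u] u s d by (auto intro!: derivative_eq_intros)
      moreover have "0 \<le> m - w u" using s3(2)[of u] u s by (simp add: m_def)
      ultimately show "\<exists>y. ((\<lambda>u. m * u - r u) has_real_derivative y) (at u) \<and> 0 \<le> y" by blast
    qed (use s in simp)
    then show ?thesis using zero by simp
  qed
  have m: "m > 0"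
  proof (rule ccontr)
    assume "\<not> m > 0"
    then have "m * d \<le> 0" using d by (simp add: mult_nonpos_nonneg)
    then show False using rm[of d] rpos[of d] d by simp
  qed
  \<comment> \<open>Between the last point of \<open>B\<close> and \<open>s3\<close> both
    \<open>r\<close> and \<open>w\<close> are positive and at most \<open>m\<close>, which removes
    the absolute values from the bound on \<open>k\<close>.\<close>
  define B where "B = {s\<in>{0..s3}. w s \<le> 0}"
  have "closedin (top_of_set {0..s3}) ({0..s3} \<inter> w -` {..0})"
    using continuous_on_subset[OF wcont] s3(1) d by (intro continuous_closedin_preimage) auto
  moreover have "{0..s3} \<inter> w -` {..0} = B" by (auto simp: B_def)
  ultimately have "compact B" using closedin_compact[of "{0..s3}"] by simp
  moreover have "0 \<in> B" using s3(1) zero by (simp add: B_def)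
  ultimately obtain s4 where s4: "s4 \<in> B" "\<And>s. s \<in> B \<Longrightarrow> s \<le> s4"
    using compact_attains_sup[of B] by blast
  have s43: "s4 < s3"
    using s4(1) m by (cases "s4 = s3") (auto simp: B_def m_def)
  obtain \<xi> where \<xi>: "s4 < \<xi>" "\<xi> < s3" "w s3 - w s4 = (s3 - s4) * k \<xi>"
    using MVT2[OF s43, of w k] w s4(1) s3(1) d by (force simp: B_def)
  have \<xi>0: "0 \<le> \<xi>" "\<xi> \<le> d" "\<xi> \<le> \<delta>" "0 < \<xi>" using \<xi> s4(1) s3(1) d by (auto simp: B_def)
  have "\<xi> \<notin> B" using s4(2) \<xi>(1) by force
  then have "w \<xi> > 0" using \<xi> \<xi>0 by (auto simp: B_def)
  moreover have "w \<xi> \<le> m" using s3(2) \<xi>0 by (simp add: m_def)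
  moreover have "r \<xi> > 0" using rpos \<xi>0 by simp
  moreover have "r \<xi> \<le> m"
  proof -
    have "m * \<xi> \<le> m * 1" using m \<xi>0(2) d1 by (intro mult_left_mono) auto
    then show ?thesis using rm[OF \<xi>0(1,2)] by simp
  qed
  ultimately have "\<bar>r \<xi>\<bar> + \<bar>w \<xi>\<bar> \<le> 2 * m" by simp
  then have "k \<xi> \<le> c * (2 * m)"
    using k[of \<xi>] \<xi>0 mult_left_mono[OF _ c] by (meson atLeastAtMost_iff order_trans)
  then have "(s3 - s4) * k \<xi> \<le> (s3 - s4) * (c * (2 * m))" using s43 by (intro mult_left_mono) auto
  also have "\<dots> \<le> d * (c * (2 * m))"
    using s3(1) s4(1) c m by (intro mult_right_mono) (auto simp: B_def)
  also have "\<dots> = d * c * (2 * m)" by simp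
  also have "\<dots> \<le> 1 / 4 * (2 * m)" using dc m by (intro mult_right_mono) auto
  finally have "w s3 - w s4 \<le> m / 2" unfolding \<xi>(3) by simp
  moreover have "w s4 \<le> 0" using s4(1) by (simp add: B_def)
  ultimately show False using m by (simp add: m_def)
qed

text \<open>Strict differentiability on the product, applied to pairs with equal second component,
  is uniform in \<open>b\<close>. The second conclusion identifies \<open>d\<close> by directional
  derivatives, the form in which \<open>exists_transversal_tangency\<close> delivers its
  information.\<close>

lemma partial_strict_derivative:
  fixes f :: "(real^2) \<times> (real^2) \<Rightarrow> real"
  assumes f: "CK 1 S f" and S: "open S" "(p, q) \<in> S"
  obtains d where "\<forall>\<eta>>0. \<exists>r>0. \<forall>x\<in>ball p r. \<forall>y\<in>ball p r. \<forall>b\<in>ball q r.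
      \<bar>f (x, b) - f (y, b) - (x - y) \<bullet> d\<bar> \<le> \<eta> * norm (x - y)"
    and "\<And>v. ((\<lambda>t. f (p + t *\<^sub>R v, q)) has_real_derivative v \<bullet> d) (at 0)"
proof -
  obtain f' where f': "\<And>x. x \<in> S \<Longrightarrow> (f has_derivative (\<lambda>h. \<Sum>i\<in>Basis. (h \<bullet> i) * f' i x)) (at x)"
    "\<And>i. i \<in> Basis \<Longrightarrow> continuous_on S (f' i)" using f by (auto simp: One_nat_def)
  define l where "l h = (\<Sum>i\<in>Basis. (h \<bullet> i) * f' i (p, q))" for h
  have l: "linear l"
    unfolding l_def by (rule linearI)
      (simp_all only: inner_add_left inner_scaleR_left distrib_right sum.distrib sum_distrib_left mult.assoc real_scaleR_def)
  define d where "d = (vector [l (axis 1 1, 0), l (axis 2 1, 0)] :: real^2)"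
  have ld: "l (h, 0) = h \<bullet> d" for h
  proof -
    have "(h, 0) = h $ 1 *\<^sub>R (axis 1 1, 0 :: real^2) + h $ 2 *\<^sub>R (axis 2 1, 0)"
      by (simp add: vec_eq_iff forall_2 axis_def)
    then have "l (h, 0) = l (h $ 1 *\<^sub>R (axis 1 1, 0) + h $ 2 *\<^sub>R (axis 2 1, 0))" by simp
    also have "\<dots> = h $ 1 * l (axis 1 1, 0) + h $ 2 * l (axis 2 1, 0)"
      unfolding linear_add[OF l] linear_scale[OF l] by simp
    finally show ?thesis by (simp add: d_def inner_2)
  qed
  have strict: "\<exists>r>0. \<forall>x\<in>ball p r. \<forall>y\<in>ball p r. \<forall>b\<in>ball q r.
      \<bar>f (x, b) - f (y, b) - (x - y) \<bullet> d\<bar> \<le> \<eta> * norm (x - y)" if "\<eta> > 0" for \<eta>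
  proof -
    obtain r where r: "r > 0" "\<And>x y. x\<in>ball (p, q) r \<Longrightarrow> y\<in>ball (p, q) r \<Longrightarrow>
        \<bar>f x - f y - l (x - y)\<bar> \<le> \<eta> * norm (x - y)"
      using C1_strictly_differentiable[OF f' S \<open>\<eta> > 0\<close>] unfolding l_def by blast
    have "\<bar>f (x, b) - f (y, b) - (x - y) \<bullet> d\<bar> \<le> \<eta> * norm (x - y)"
      if "x \<in> ball p (r/2)" "y \<in> ball p (r/2)" "b \<in> ball q (r/2)" for x y b
    proof -
      have ball: "(z, b) \<in> ball (p, q) r" if "z \<in> ball p (r/2)" for z
        using norm_Pair_le[of "p - z" "q - b"] that \<open>b \<in> ball q (r/2)\<close> by (simp add: dist_norm)
      show ?thesis using r(2)[OF ball[OF that(1)] ball[OF that(2)]] by (simp add: ld norm_Pair)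
    qed
    then show "\<exists>r>0. \<forall>x\<in>ball p r. \<forall>y\<in>ball p r. \<forall>b\<in>ball q r.
        \<bar>f (x, b) - f (y, b) - (x - y) \<bullet> d\<bar> \<le> \<eta> * norm (x - y)"
      using r(1) by (intro exI[of _ "r/2"]) auto
  qed
  have "((\<lambda>t. f (p + t *\<^sub>R v, q)) has_real_derivative v \<bullet> d) (at 0)" for v
  proof -
    have "((\<lambda>t. (p + t *\<^sub>R v, q)) has_derivative (\<lambda>t. (t *\<^sub>R v, 0))) (at 0)"
      by (auto intro!: derivative_eq_intros)
    moreover have "(f has_derivative l) (at (p + 0 *\<^sub>R v, q))"
      using f'(1)[OF S(2)] by (simp add: l_def[abs_def])
    ultimately have "((\<lambda>t. f (p + t *\<^sub>R v, q)) has_derivative (\<lambda>t. l (t *\<^sub>R v, 0))) (at 0)"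
      by (rule has_derivative_compose)
    moreover have "(\<lambda>t. l (t *\<^sub>R v, 0)) = (*) (v \<bullet> d)" by (auto simp: ld fun_eq_iff)
    ultimately show "((\<lambda>t. f (p + t *\<^sub>R v, q)) has_real_derivative v \<bullet> d) (at 0)"
      by (simp add: has_field_derivative_def)
  qed
  with strict show thesis using that by blast
qed

lemma smooth_on_strict_derivative:
  fixes \<rho> :: "real^2 \<Rightarrow> real"
  assumes V: "open V" "smooth_on V \<rho>" "p \<in> V" and \<eta>: "\<eta> > 0"
  shows "\<exists>r>0. \<forall>x\<in>ball p r. \<forall>y\<in>ball p r. \<bar>\<rho> x - \<rho> y - (x - y) \<bullet> grad \<rho> p\<bar> \<le> \<eta> * norm (x - y)"
proof -
  obtain f' where f': "\<And>x. x \<in> V \<Longrightarrow> (\<rho> has_derivative (\<lambda>h. \<Sum>i\<in>Basis. (h \<bullet> i) * f' i x)) (at x)"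
    "\<And>i. i \<in> Basis \<Longrightarrow> continuous_on V (f' i)"
    using smooth_on_imp_CK[OF V(1,2), of 1] by (auto simp: One_nat_def)
  have "(\<lambda>h. \<Sum>i\<in>Basis. (h \<bullet> i) * f' i p) = (\<lambda>h. h \<bullet> grad \<rho> p)"
    by (rule has_derivative_unique[OF f'(1)[OF V(3)] smooth_on_has_derivative[OF V]])
  then have "(\<Sum>i\<in>Basis. (h \<bullet> i) * f' i p) = h \<bullet> grad \<rho> p" for h by metis
  then show ?thesis using C1_strictly_differentiable[OF f' V(1,3) \<eta>] by auto
qed

text \<open>Denying the claim makes the points with different gradients dense in \<open>G\<close>,
  and it is through this density that the negation enters.\<close>

lemma gradients_agree_on_open_set:
  assumes Q: "smooth_on UNIV Q" and Q': "smooth_on UNIV Q'"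
    and \<Omega>: "open \<Omega>" "smooth_boundary \<Omega>" and p: "p \<in> frontier \<Omega>" "strictly_convex_wrt Q \<Omega> p"
    and G: "open G" "p \<in> G"
    and data: "\<And>x y. x \<in> frontier \<Omega> \<Longrightarrow> y \<in> G - \<Omega> \<Longrightarrow> x \<noteq> y \<Longrightarrow> exit_time Q \<Omega> x y < \<infinity>"
      "\<And>x y. x \<in> frontier \<Omega> \<Longrightarrow> y \<in> G - \<Omega> \<Longrightarrow> x \<noteq> y \<Longrightarrow> measurement Q' \<Omega> x y = measurement Q \<Omega> x y"
  shows "\<exists>y\<in>G. \<exists>e>0. ball y e \<subseteq> G \<and> (\<forall>b\<in>ball y e. perp_grad Q' b = perp_grad Q b)"
proof (rule ccontr)
  assume neg: "\<not> ?thesis"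
  have dense: "\<exists>b\<in>ball y e. perp_grad Q' b \<noteq> perp_grad Q b" if "ball y e \<subseteq> G" "e > 0" for y e
    using neg that centre_in_ball[of y e] by blast
  obtain V \<rho> where ldf: "local_defining_function \<Omega> p V \<rho>"
    using \<Omega>(2) p(1) by (auto simp: smooth_boundary_def)
  then have V: "open V" "smooth_on V \<rho>" "p \<in> V" "grad \<rho> p \<noteq> 0" "\<Omega> \<inter> V = {x\<in>V. \<rho> x < 0}"
    by (auto simp: local_defining_function_def)
  have \<rho>p: "\<rho> p = 0" by (rule local_defining_function_zero[OF ldf \<Omega>(1) p(1)])
  obtain Vp where Vp: "open Vp" "p \<in> Vp"
    and convex: "\<And>q. q \<in> Vp - \<Omega> \<Longrightarrow> q \<noteq> p \<Longrightarrow> tangent_to_boundary \<Omega> p (vector_derivative (a_plus Q p q) (at 0)) \<Longrightarrow>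
      \<exists>\<delta>>0. \<forall>s\<in>{-\<delta><..<\<delta>} - {0}. s \<in> life Q p q \<and> a_plus Q p q s \<notin> closure \<Omega>"
    using p(2) unfolding strictly_convex_wrt_def by blast
  define T :: "real^2" where "T = vector [- grad \<rho> p $ 2, grad \<rho> p $ 1]"
  obtain q \<delta> where q: "q \<in> Vp \<inter> G" "q \<in> V" "q \<noteq> p" "\<rho> q > 0" "normal_speed \<rho> Q (p, q) = 0" "\<delta> > 0"
    and \<delta>: "((\<lambda>t. normal_speed \<rho> Q (p + t *\<^sub>R T, q)) has_real_derivative \<delta>) (at 0)"
    using exists_transversal_tangency[OF V(1-3) \<rho>p refl V(4) Q open_Int[OF Vp(1) G(1)] _ T_def] Vp(2) G(2) by blast
  have qc: "q \<notin> closure \<Omega>" by (rule local_defining_function_outside[OF ldf q(2,4)])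
  then have q\<Omega>: "q \<notin> \<Omega>" using closure_subset by blast
  define S where "S = {X. fst X \<in> V} \<inter> off_diagonal"
  have "open {X :: (real^2) \<times> (real^2). fst X \<in> V}"
    using open_vimage_fst[OF V(1)] by (simp add: vimage_def)
  then have S: "open S" "(p, q) \<in> S" using V(3) q(3) open_off_diagonal by (auto simp: S_def off_diagonal_def)
  define f where "f = normal_speed \<rho> Q"
  have fC: "CK n S f" for n unfolding f_def S_def by (rule CK_normal_speed[OF V(1,2) Q])
  have FC: "CK n S (\<lambda>X. dipole_field Q X \<bullet> i)" if "i \<in> Basis" for n i
    using CK_subset[OF CK_dipole_field[OF Q that]] by (auto simp: S_def)
  obtain k where k: "CK 1 S k"
    "\<And>Z s. (Z has_vector_derivative dipole_field Q (Z s)) (at s) \<Longrightarrow> Z s \<in> S \<Longrightarrow>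
        ((\<lambda>s. f (Z s)) has_real_derivative k (Z s)) (at s)"
    by (rule CK_derivative_along_field[OF fC[of "Suc 1"] FC]) blast+
  have fcont: "continuous_on S f" and kcont: "continuous_on S k"
    using fC k(1) CK_imp_continuous_on by blast+
  obtain d where d: "\<forall>\<eta>>0. \<exists>r>0. \<forall>x\<in>ball p r. \<forall>y\<in>ball p r. \<forall>b\<in>ball q r.
      \<bar>f (x, b) - f (y, b) - (x - y) \<bullet> d\<bar> \<le> \<eta> * norm (x - y)"
    and dv: "\<And>v. ((\<lambda>t. f (p + t *\<^sub>R v, q)) has_real_derivative v \<bullet> d) (at 0)"
    using partial_strict_derivative[OF fC S] by blast
  have "T \<bullet> d = \<delta>" using DERIV_unique[OF dv[of T]] \<delta> by (simp add: f_def)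
  \<comment> \<open>This determinant is \<open>T \<bullet> d = \<delta>\<close>: transversality of
    \<open>(p, q)\<close> is what metric regularity asks for.\<close>
  then have det: "grad \<rho> p $ 1 * d $ 2 - grad \<rho> p $ 2 * d $ 1 \<noteq> 0"
    using q(6) by (simp add: T_def inner_2)
  have slice: "isCont (\<lambda>b. f (x, b)) b" if "(x, b) \<in> S" for x b
  proof -
    have "isCont f (x, b)" using that fcont continuous_on_eq_continuous_at[OF S(1)] by blast
    moreover have "isCont (Pair x) b" by (intro continuous_intros)
    ultimately show ?thesis using isCont_o2[of b "Pair x" f] by blast
  qed
  have fpq: "f (p, q) = 0" using q(5) by (simp add: f_def)
  have "\<forall>\<eta>>0. \<exists>r>0. \<forall>x\<in>ball p r. \<forall>y\<in>ball p r.
      \<bar>\<rho> x - \<rho> y - (x - y) \<bullet> grad \<rho> p\<bar> \<le> \<eta> * norm (x - y)"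
    using smooth_on_strict_derivative[OF V(1-3)] by blast
  note regular = two_equations_metrically_regular[OF this d slice[OF S(2)] \<rho>p fpq det]
  obtain r2 L where r2: "r2 > 0" "ball (p, q) r2 \<subseteq> S" and
    L: "\<And>X Y. X \<in> ball (p, q) r2 \<Longrightarrow> Y \<in> ball (p, q) r2 \<Longrightarrow> \<bar>k X - k Y\<bar> \<le> L * norm (X - Y)"
    using CK1_locally_Lipschitz[OF k(1) S] by blast
  have pair: "(a, b) \<in> ball (p, q) r2" if "a \<in> ball p (r2 / 2)" "b \<in> ball q (r2 / 2)" for a b
    using norm_Pair_le[of "p - a" "q - b"] that by (simp add: dist_norm)
  have "r2 / 2 > 0" using r2(1) by simp
  \<comment> \<open>First use of regularity: it provides the starting points of chords and
    tangential states close to a given one.\<close>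
  from regular[OF this] obtain r1 C1 where r1: "r1 > 0" "C1 > 0" and
    reg1: "\<And>a b r0 w0. a \<in> ball p r1 \<Longrightarrow> b \<in> ball q r1 \<Longrightarrow> \<bar>r0\<bar> < r1 \<Longrightarrow> \<bar>w0\<bar> < r1 \<Longrightarrow>
      \<exists>x\<in>ball p (r2 / 2). \<rho> x = r0 \<and> f (x, b) = w0 \<and> norm (a - x) \<le> C1 * (\<bar>\<rho> a - r0\<bar> + \<bar>f (a, b) - w0\<bar>)"
    by metis
  define e1 where "e1 = min r1 (r2 / 2)"
  have e1: "e1 > 0" using r1 r2 by (simp add: e1_def)
  define B where "B = ball q e1 \<inter> G \<inter> (- closure \<Omega>)"
  have B: "open B" "q \<in> B" using e1 G(1) q(1) qc by (auto simp: B_def)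
  have inS: "(a, b) \<in> S" if "a \<in> ball p e1" "b \<in> B" for a b
    using pair[of a b] that r2(2) by (auto simp: e1_def B_def)
  have k_le_generic: "k (x0, b) \<le> 0"
    if x0: "x0 \<in> ball p e1" "\<rho> x0 = 0" "f (x0, b) = 0" and b: "b \<in> B" "perp_grad Q' b \<noteq> perp_grad Q b" for x0 b
  proof (rule ccontr)
    assume "\<not> k (x0, b) \<le> 0"
    have st: "(x0, b) \<in> S" by (rule inS[OF x0(1) b(1)])
    have "perp_grad Q' b = perp_grad Q b"
    proof (rule short_chords_determine_gradient[OF Q Q' \<Omega>(1) ldf, where k = k and ?\<epsilon>0.0 = r1 and C = C1])
      show "x0 \<in> V" "x0 \<noteq> b" using st by (auto simp: S_def off_diagonal_def)
      show "b \<notin> closure \<Omega>" using b(1) by (simp add: B_def)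
      show "continuous_on ({X. fst X \<in> V} \<inter> off_diagonal) k" using kcont by (simp add: S_def)
      show "((\<lambda>s. normal_speed \<rho> Q (Z s)) has_real_derivative k (Z s)) (at s)"
        if "(Z has_vector_derivative dipole_field Q (Z s)) (at s)" "Z s \<in> {X. fst X \<in> V} \<inter> off_diagonal" for Z s
        using k(2)[OF that(1)] that(2) by (simp add: f_def S_def)
      show "0 < k (x0, b)" using \<open>\<not> k (x0, b) \<le> 0\<close> by simp
      \<comment> \<open>At \<open>(x0, b)\<close> both residuals vanish, so the right-hand sides
        \<open>0\<close> and \<open>- \<epsilon>\<close> are solved within distance
        \<open>C1 * \<epsilon>\<close> of \<open>x0\<close>.\<close>
      show "\<exists>x. \<rho> x = 0 \<and> normal_speed \<rho> Q (x, b) = - \<epsilon> \<and> norm (x - x0) \<le> C1 * \<epsilon>" if "0 < \<epsilon>" "\<epsilon> < r1" for \<epsilon>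
        using reg1[of x0 b 0 "- \<epsilon>"] x0 b(1) that r1 by (force simp: e1_def B_def f_def norm_minus_commute)
      show "exit_time Q \<Omega> x b < \<infinity>" "measurement Q' \<Omega> x b = measurement Q \<Omega> x b"
        if "x \<in> frontier \<Omega>" "x \<noteq> b" for x
        using data[OF that(1) _ that(2)] b(1) closure_subset by (auto simp: B_def)
    qed (use r1 in auto)
    then show False using b(2) by simp
  qed
  \<comment> \<open>If \<open>k\<close> were positive at \<open>(x0, b)\<close>, the second vortex
    could be moved to a nearby \<open>b'\<close> with different gradients and the tangency solved
    again near \<open>x0\<close>; \<open>k\<close> would still be positive, against
    \<open>k_le_generic\<close>.\<close>
  have k_le: "k (x0, b) \<le> 0" if x0: "x0 \<in> ball p e1" "\<rho> x0 = 0" "f (x0, b) = 0" and b: "b \<in> B" for x0 b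
  proof (rule ccontr)
    assume k0: "\<not> k (x0, b) \<le> 0"
    have st: "(x0, b) \<in> S" by (rule inS[OF x0(1) b])
    have "\<forall>\<^sub>F X in nhds (x0, b). 0 < k X"
      using kcont S(1) st k0 unfolding continuous_on_eq_continuous_at[OF S(1)] isCont_def tendsto_at_iff_tendsto_nhds
      by (intro order_tendstoD) auto
    then obtain e where e: "e > 0" and ke: "\<And>X. dist X (x0, b) < e \<Longrightarrow> 0 < k X"
      unfolding eventually_nhds_metric by blast
    obtain e' where e': "e' > 0" "ball x0 e' \<subseteq> ball p e1"
      using x0(1) by (meson open_ball openE)
    define m where "m = min (e / 2) e'"
    have m: "m > 0" using e e' by (simp add: m_def)
    have "((\<lambda>b'. f (x0, b')) \<longlongrightarrow> 0) (nhds b)"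
      using slice[OF st] tendsto_at_iff_tendsto_nhds[of "\<lambda>b'. f (x0, b')" b]
      unfolding isCont_def by (simp only: x0(3))
    then have "\<forall>\<^sub>F b' in nhds b. dist (f (x0, b')) 0 < m / C1"
      using m r1(2) by (intro tendstoD) auto
    moreover have "\<forall>\<^sub>F b' in nhds b. b' \<in> B" using B(1) b by (rule eventually_nhds_in_open)
    ultimately have "\<forall>\<^sub>F b' in nhds b. b' \<in> B \<and> \<bar>f (x0, b')\<bar> < m / C1"
      by eventually_elim auto
    then obtain e2 where e2: "e2 > 0" and be: "\<And>b'. dist b' b < e2 \<Longrightarrow> b' \<in> B \<and> \<bar>f (x0, b')\<bar> < m / C1"
      unfolding eventually_nhds_metric by blast
    have "ball b (min e2 m) \<subseteq> G" using be by (auto simp: B_def dist_commute)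
    then obtain b' where b': "b' \<in> ball b (min e2 m)" "perp_grad Q' b' \<noteq> perp_grad Q b'"
      using dense[of b "min e2 m"] e2 m by auto
    have bB: "b' \<in> B" "\<bar>f (x0, b')\<bar> < m / C1" using be[of b'] b'(1) by (auto simp: dist_commute)
    obtain x where x: "\<rho> x = 0" "f (x, b') = 0" "norm (x0 - x) \<le> C1 * \<bar>f (x0, b')\<bar>"
      using reg1[of x0 b' 0 0] x0 bB(1) r1(1) by (auto simp: e1_def B_def)
    have "C1 * \<bar>f (x0, b')\<bar> < m" using bB(2) r1(2) by (simp add: field_simps)
    then have xm: "norm (x0 - x) < m" using x(3) by simp
    then have "x \<in> ball p e1" using e'(2) by (auto simp: subset_iff dist_norm m_def)
    then have "k (x, b') \<le> 0" by (rule k_le_generic[OF _ x(1,2) bB(1) b'(2)])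
    moreover have "dist (x, b') (x0, b) < e"
    proof -
      have "dist (x, b') (x0, b) \<le> norm (x - x0) + norm (b' - b)"
        using norm_Pair_le[of "x - x0" "b' - b"] by (simp add: dist_norm)
      also have "\<dots> < m + m" using xm b'(1) by (intro add_strict_mono) (auto simp: dist_norm norm_minus_commute)
      also have "\<dots> \<le> e" by (simp add: m_def)
      finally show ?thesis .
    qed
    ultimately show False using ke by force
  qed
  \<comment> \<open>Second use, with radius \<open>e1\<close>: the tangential state found must lie
    where \<open>k_le\<close> applies.\<close>
  from regular[OF e1] obtain r3 C3 where r3: "r3 > 0" "C3 > 0" and
    reg3: "\<And>a b r0 w0. a \<in> ball p r3 \<Longrightarrow> b \<in> ball q r3 \<Longrightarrow> \<bar>r0\<bar> < r3 \<Longrightarrow> \<bar>w0\<bar> < r3 \<Longrightarrow>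
      \<exists>x\<in>ball p e1. \<rho> x = r0 \<and> f (x, b) = w0 \<and> norm (a - x) \<le> C3 * (\<bar>\<rho> a - r0\<bar> + \<bar>f (a, b) - w0\<bar>)"
    by metis
  define c where "c = \<bar>L\<bar> * C3"
  \<comment> \<open>Comparison with a tangential state \<open>(x, b)\<close> for the same
    \<open>b\<close>: there \<open>k \<le> 0\<close>, the two residuals bound its distance from
    \<open>(a, b)\<close>, and \<open>k\<close> is Lipschitz.\<close>
  have k_bound: "k (a, b) \<le> c * (\<bar>\<rho> a\<bar> + \<bar>f (a, b)\<bar>)"
    if ab: "a \<in> ball p r3" "a \<in> ball p e1" "b \<in> ball q r3" "b \<in> B" for a b
  proof -
    obtain x where x: "x \<in> ball p e1" "\<rho> x = 0" "f (x, b) = 0" "norm (a - x) \<le> C3 * (\<bar>\<rho> a\<bar> + \<bar>f (a, b)\<bar>)"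
      using reg3[OF ab(1,3), of 0 0] r3(1) by auto
    have "(a, b) \<in> ball (p, q) r2" "(x, b) \<in> ball (p, q) r2"
      using pair ab x(1) by (auto simp: e1_def B_def)
    then have "\<bar>k (a, b) - k (x, b)\<bar> \<le> L * norm (a - x)" using L by (force simp: norm_Pair)
    also have "\<dots> \<le> \<bar>L\<bar> * norm (a - x)" by (intro mult_right_mono) auto
    also have "\<dots> \<le> \<bar>L\<bar> * (C3 * (\<bar>\<rho> a\<bar> + \<bar>f (a, b)\<bar>))" by (intro mult_left_mono x(4)) auto
    finally show ?thesis using k_le[OF x(1-3) ab(4)] by (simp add: c_def mult.assoc)
  qed
  have "exit_time Q \<Omega> p q < \<infinity>" using data(1)[OF p(1)] q(1,3) q\<Omega> by auto
  then obtain J ap am where sol: "dipole_solution Q p q J ap am"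
    by (rule exit_time_finite_solution[OF Q])
  note curve = dipole_solution_curve[OF sol]
  have J: "open J" "is_interval J" using sol by (auto simp: dipole_solution_def)
  \<comment> \<open>Strict convexity speaks of \<open>a_plus\<close>, which is known to agree with
    \<open>ap\<close> on the open interval \<open>J\<close>; this is enough to transfer the
    derivative at 0.\<close>
  have "(a_plus Q p q has_vector_derivative fst (dipole_field Q (p, q))) (at 0)"
  proof (rule has_vector_derivative_transform_within_open[OF _ J(1) curve(4)])
    show "(ap has_vector_derivative fst (dipole_field Q (p, q))) (at 0)"
      using bounded_linear.has_vector_derivative[OF bounded_linear_fst curve(1)[OF curve(4)]] curve(2,3) by simp
    show "ap s = a_plus Q p q s" if "s \<in> J" for s
      using dipole_solution_a(1)[OF Q sol that] by simp
  qed
  then have "vector_derivative (a_plus Q p q) (at 0) = fst (dipole_field Q (p, q))"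
    by (rule vector_derivative_at)
  then have "tangent_to_boundary \<Omega> p (vector_derivative (a_plus Q p q) (at 0))"
    unfolding tangent_to_boundary_def using ldf q(5) by (auto simp: normal_speed_def)
  then obtain \<delta>0 where \<delta>0: "\<delta>0 > 0" "\<And>s. s \<in> {-\<delta>0<..<\<delta>0} - {0} \<Longrightarrow> a_plus Q p q s \<notin> closure \<Omega>"
    using convex[of q] q(1,3) q\<Omega> by blast
  have "isCont (\<lambda>s. (ap s, am s)) 0"
    using has_vector_derivative_continuous[OF curve(1)[OF curve(4)]] .
  then have lim: "((\<lambda>s. (ap s, am s)) \<longlongrightarrow> (p, q)) (nhds 0)"
    using tendsto_at_iff_tendsto_nhds[of "\<lambda>s. (ap s, am s)" 0] unfolding isCont_def by (simp only: curve(2,3))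
  define O' where "O' = (ball p r3 \<inter> ball p e1) \<times> (ball q r3 \<inter> B)"
  have "open O'" "(p, q) \<in> O'" using B e1 r3 by (auto simp: O'_def intro: open_Times)
  then have "\<forall>\<^sub>F s in nhds 0. (ap s, am s) \<in> O'" using lim by (rule topological_tendstoD[rotated])
  moreover have "\<forall>\<^sub>F s in nhds 0. s \<in> J" using J(1) curve(4) by (rule eventually_nhds_in_open)
  ultimately have "\<forall>\<^sub>F s in nhds 0. s \<in> J \<and> (ap s, am s) \<in> O'" by eventually_elim auto
  then obtain e where e: "e > 0" and near: "\<And>s. \<bar>s\<bar> < e \<Longrightarrow> s \<in> J \<and> (ap s, am s) \<in> O'"
    unfolding eventually_nhds_metric by (auto simp: dist_real_def)
  define s0 where "s0 = min e \<delta>0 / 2"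
  have s0: "s0 > 0" "s0 < e" "s0 < \<delta>0" using e \<delta>0(1) by (auto simp: s0_def)
  have sJ: "s \<in> J" "ap s \<in> ball p r3" "ap s \<in> ball p e1" "am s \<in> ball q r3" "am s \<in> B" "(ap s, am s) \<in> S"
    if "s \<in> {0..s0}" for s
    using near[of s] that s0 inS by (auto simp: O'_def)
  have "\<exists>s\<in>{0<..s0}. \<rho> (ap s) \<le> 0"
  proof (rule second_order_no_escape[OF s0(1), where w = "\<lambda>s. f (ap s, am s)" and k = "\<lambda>s. k (ap s, am s)" and c = c])
    fix s assume s: "s \<in> {0..s0}"
    show "((\<lambda>s. \<rho> (ap s)) has_real_derivative f (ap s, am s)) (at s)"
      unfolding f_def using sJ[OF s] by (intro dipole_solution_defining_function[OF V(1,2) sol]) (auto simp: S_def)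
    show "((\<lambda>s. f (ap s, am s)) has_real_derivative k (ap s, am s)) (at s)"
      using sJ[OF s] by (intro k(2)[where Z = "\<lambda>s. (ap s, am s)"] curve(1))
    show "k (ap s, am s) \<le> c * (\<bar>\<rho> (ap s)\<bar> + \<bar>f (ap s, am s)\<bar>)"
      using sJ[OF s] by (intro k_bound)
  qed (use r3 \<rho>p fpq curve(2,3) in \<open>auto simp: c_def\<close>)
  then obtain s where s: "0 < s" "s \<le> s0" "\<rho> (ap s) \<le> 0" by auto
  have out: "ap s \<notin> closure \<Omega>"
    using \<delta>0(2)[of s] s s0 dipole_solution_a(1)[OF Q sol sJ(1)[of s]] by auto
  have sV: "ap s \<in> V" using sJ(6)[of s] s by (auto simp: S_def)
  \<comment> \<open>Both remaining signs are impossible outside the closure: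
    \<open>\<rho> = 0\<close> would put the point on the frontier, \<open>\<rho> < 0\<close> in the
    domain.\<close>
  have "\<rho> (ap s) \<noteq> 0"
    using local_defining_function_boundary[OF ldf \<Omega>(1) sV] out by (auto simp: frontier_def)
  then have "ap s \<in> \<Omega>" using s(3) sV V(5) by (metis (mono_tags, lifting) Int_iff less_eq_real_def mem_Collect_eq)
  then show False using out closure_subset by blast
qed

section \<open>From an open set to the whole disc\<close>

theorem theorem1p2:
  fixes Q :: "real^2 \<Rightarrow> real" and \<Omega> :: "(real^2) set"
  assumes "smooth_on UNIV Q"
    and "open \<Omega>" and "bounded \<Omega>" and "convex \<Omega>" and "\<Omega> \<noteq> {}" and "smooth_boundary \<Omega>"
    and "\<exists>p\<in>frontier \<Omega>. strictly_convex_wrt Q \<Omega> p"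
  shows "\<exists>W. open W \<and> closure \<Omega> \<subseteq> W \<and>
    (real_analytic_on W Q \<longrightarrow>
      (\<forall>U Q'. open U \<and> closure W \<subseteq> U \<and> admissible_potential \<Omega> U Q \<and>
         smooth_on UNIV Q' \<and> real_analytic_on W Q' \<and> admissible_potential \<Omega> U Q' \<and>
         (\<exists>p\<in>frontier \<Omega>. strictly_convex_wrt Q' \<Omega> p) \<and>
         (\<forall>x\<in>- W. Q' x = Q x) \<and>
         (\<forall>x\<in>frontier \<Omega>. \<forall>y\<in>U - \<Omega>. x \<noteq> y \<longrightarrow> measurement Q' \<Omega> x y = measurement Q \<Omega> x y) \<longrightarrow>
         (\<forall>x\<in>W. Q' x = Q x)))"
proof -
  obtain p where p: "p \<in> frontier \<Omega>" "strictly_convex_wrt Q \<Omega> p" using assms(7) by blast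
  obtain R where R: "closure \<Omega> \<subseteq> ball 0 R"
    using bounded_subset_ballD[OF bounded_closure[OF assms(3)]] by blast
  \<comment> \<open>A disc is convex, as continuation along segments demands, and it is chosen from
    \<open>\<Omega>\<close> alone.\<close>
  define W where "W = ball (0 :: real^2) R"
  have pW: "p \<in> W" using p(1) R by (auto simp: frontier_def W_def)
  then have "R > 0" by (auto simp: W_def intro: le_less_trans[OF norm_ge_zero])
  have main: "\<forall>x\<in>W. Q' x = Q x"
    if an: "real_analytic_on W Q" and U: "open U" "closure W \<subseteq> U" "admissible_potential \<Omega> U Q"
      and Q': "smooth_on UNIV Q'" "real_analytic_on W Q'" and out: "\<forall>x\<in>- W. Q' x = Q x"
      and eq: "\<forall>x\<in>frontier \<Omega>. \<forall>y\<in>U - \<Omega>. x \<noteq> y \<longrightarrow> measurement Q' \<Omega> x y = measurement Q \<Omega> x y" for U Q'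
  proof -
    have WU: "W \<subseteq> U" using U(2) closure_subset by blast
    have "\<exists>y\<in>W. \<exists>e>0. ball y e \<subseteq> W \<and> (\<forall>b\<in>ball y e. perp_grad Q' b = perp_grad Q b)"
    proof (rule gradients_agree_on_open_set[OF assms(1) Q'(1) assms(2,6) p _ pW])
      show "exit_time Q \<Omega> x y < \<infinity>" if "x \<in> frontier \<Omega>" "y \<in> W - \<Omega>" "x \<noteq> y" for x y
        using U(3) WU that unfolding admissible_potential_def by blast
      show "measurement Q' \<Omega> x y = measurement Q \<Omega> x y" if "x \<in> frontier \<Omega>" "y \<in> W - \<Omega>" "x \<noteq> y" for x y
        using eq WU that by blast
    qed (simp add: W_def)
    then obtain y e where y: "y \<in> W" "e > 0" "ball y e \<subseteq> W" "\<And>b. b \<in> ball y e \<Longrightarrow> perp_grad Q' b = perp_grad Q b"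
      by blast
    have cont: "continuous_on A Q" "continuous_on A Q'" for A
      using assms(1) Q'(1) continuous_on_subset[OF CK_imp_continuous_on[OF smooth_on_imp_CK[OF open_UNIV]]]
      by blast+
    have "\<exists>c. \<forall>x\<in>ball y e. Q' x - Q x = c"
    proof (rule has_derivative_zero_constant[OF convex_ball])
      fix x assume x: "x \<in> ball y e"
      have "perp_grad Q' x = perp_grad Q x" by (rule y(4)[OF x])
      then have g: "grad Q' x = grad Q x"
        using perp_grad_nth[of Q' x] perp_grad_nth[of Q x] by (simp add: vec_eq_iff forall_2 grad_nth)
      have "((\<lambda>x. Q' x - Q x) has_derivative (\<lambda>h. h \<bullet> grad Q' x - h \<bullet> grad Q x)) (at x)"
        using assms(1) Q'(1) by (intro has_derivative_diff smooth_on_has_derivative[OF open_UNIV]) auto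
      then show "((\<lambda>x. Q' x - Q x) has_derivative (\<lambda>h. 0)) (at x within ball y e)"
        unfolding g by (simp add: has_derivative_at_withinI)
    qed
    then obtain c where c: "\<And>x. x \<in> ball y e \<Longrightarrow> Q' x - Q x = c" by blast
    have "convex W" by (simp add: W_def)
    then have const: "Q' x - Q x = c" if "x \<in> W" for x
      by (rule real_analytic_diff_constant[OF Q'(2) an _ cont(2,1) y(1,2) c that])
    \<comment> \<open>A point of the bounding circle: as a limit of points of \<open>W\<close> it
      inherits the constant difference \<open>c\<close>, and as a point outside the open disc it has
      \<open>Q' z = Q z\<close>.\<close>
    define z where "z = R *\<^sub>R (axis 1 1 :: real^2)"
    have z: "z \<in> closure W" "z \<in> - W" using \<open>R > 0\<close> by (auto simp: z_def W_def)
    have "Q' z - Q z = c"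
      using continuous_constant_on_closure[of W "\<lambda>x. Q' x - Q x" c z] const z(1) cont
      by (auto intro: continuous_on_diff)
    then have "c = 0" using out z(2) by simp
    then show ?thesis using const by simp
  qed
  show ?thesis
  proof (rule exI[of _ W], intro conjI impI allI, goal_cases)
    case (3 U Q')
    then show ?case by (elim conjE) (rule main)
  qed (use R in \<open>auto simp: W_def\<close>)
qed

end
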